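(* Let $X=(V,\Sigma)$ be a non-empty connected simplicial complex with $V=\{1,\dots,n\}$, let $\mathcal{G}_0=\{G_\bullet,\psi_\bullet^\bullet\}$ be a simplicial amalgam of groups over $X$, and let $\mathcal{A}_0$ be the coefficient system associated to $\mathcal{G}_0$. Then the isomorphism classes of amalgams of type $\mathcal{G}_0$ are parametrized by $H^1(X,\mathcal{A}_0)$; that is, there is a bijection between the set of isomorphism classes of amalgams of type $\mathcal{G}_0$ and the set $H^1(X,\mathcal{A}_0)$.
   Context: **Simplicial complex.** $X=(V,\Sigma)$ with $V=\{1,\dots,n\}$, $n\ge 1$, and $\Sigma$ a collection of non-empty subsets of $V$ (simplices) containing all $\{v\}$, $v\in V$, and closed under taking non-empty subsets. $\sigma\in\Sigma$ has rank $|\sigma|-1$; $\Sigma_k$ is the set of simplices of rank $k$. $X$ is connected if the graph with vertex set $V$ and edge set $\Sigma_1$ is connected. Braces are omitted in indices: $i$, $ij$, $ijk$ stand for $\{i\},\{i,j\},\{i,j,k\}$. **Simplicial amalgam** over $X$: $\mathcal{G}=\{G_\sigma,\varphi^\sigma_\tau\mid\sigma\subseteq\tau,\ \sigma,\tau\in\Sigma\}$, written $\{G_\bullet,\varphi^\bullet_\bullet\}$, where each $G_\sigma$ is a group and $\varphi^\sigma_\tau\colon G_\tau\to G_\sigma$ is an injective homomorphism, with $\varphi^\sigma_\rho\circ\varphi^\rho_\tau=\varphi^\sigma_\tau$ whenever $\sigma\subseteq\rho\subseteq\tau$. **Isomorphism** between amalgams $\{G^{(1)}_\bullet,{}^{(1)}\varphi^\bullet_\bullet\}$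 and $\{G^{(2)}_\bullet,{}^{(2)}\varphi^\bullet_\bullet\}$ over $X$: a family $\phi=\{\phi_\sigma\mid\sigma\in\Sigma\}$ of group isomorphisms $\phi_\sigma\colon G^{(1)}_\sigma\to G^{(2)}_\sigma$ with $\phi_\sigma\circ{}^{(1)}\varphi^\sigma_\tau={}^{(2)}\varphi^\sigma_\tau\circ\phi_\tau$ for all $\sigma\subseteq\tau$. **Amalgam of type $\mathcal{G}_0$.** Put $\bar G_{\sigma,\tau}=\psi^\sigma_\tau(G_\tau)\le G_\sigma$. An amalgam of type $\mathcal{G}_0$ is an amalgam $\{G_\bullet,\varphi^\bullet_\bullet\}$ over $X$ with the same groups $G_\sigma$ as $\mathcal{G}_0$ and with $\varphi^\sigma_\tau(G_\tau)=\bar G_{\sigma,\tau}$ for all $\sigma\subseteq\tau$ in $\Sigma$. **Coefficient system of $\mathcal{G}_0$.** $\mathcal{A}_0=\{A_\bullet,\alpha^\bullet_\bullet\}$ with $A_\sigma=\{g\in\mathrm{Aut}(G_\sigma)\mid g(\bar G_{\sigma,\tau})=\bar G_{\sigma,\tau}\text{ for all }\tau\in\Sigma\text{ with }\sigma\subseteq\tau\}$ and, for $\sigma\subseteq\tau$, the homomorphism $\alpha^\sigma_\tau\colon A_\sigma\to A_\tau$, $f\mapsto(\psi^\sigma_\tau)^{-1}\circ f\circ\psi^\sigma_\tau$, where $(\psi^\sigma_\tau)^{-1}\colon\bar G_{\sigma,\tau}\to G_\tau$ is the inverse of $\psi^\sigma_\tau\colon G_\tau\to\bar G_{\sigma,\tau}$.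 **Cohomology.** $\mathcal{C}^i=\prod_{\sigma\in\Sigma_i}A_\sigma$ for $i=0,1,2$. $Z^1(X,\mathcal{A}_0)$ is the set of $(a_{ij})_{\{i,j\}\in\Sigma_1,\,i<j}\in\mathcal{C}^1$ with $\alpha^{jk}_{ijk}(a_{jk}^{-1})\,\alpha^{ik}_{ijk}(a_{ik})\,\alpha^{ij}_{ijk}(a_{ij}^{-1})=\mathrm{id}$ for all $\{i,j,k\}\in\Sigma_2$, $i<j<k$. The group $\mathcal{C}^0$ acts on the right on $\mathcal{C}^1$ by $(b_{ij})^{(a_k)}=(\alpha^j_{ij}(a_j^{-1})\,b_{ij}\,\alpha^i_{ij}(a_i))$, $i<j$; this action preserves $Z^1(X,\mathcal{A}_0)$, and $H^1(X,\mathcal{A}_0)$ is the set of $\mathcal{C}^0$-orbits on $Z^1(X,\mathcal{A}_0)$. *)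

theory Defs
  imports "HOL-Algebra.Bij" "HOL-Algebra.Product_Groups"
begin

definition simplicial_complex :: "nat \<Rightarrow> nat set set \<Rightarrow> bool" where
  "simplicial_complex n S \<longleftrightarrow>
     1 \<le> n \<and>
     (\<forall>\<sigma>\<in>S. \<sigma> \<noteq> {} \<and> \<sigma> \<subseteq> {1..n}) \<and>
     (\<forall>v\<in>{1..n}. {v} \<in> S) \<and>
     (\<forall>\<tau>\<in>S. \<forall>\<sigma>. \<sigma> \<noteq> {} \<and> \<sigma> \<subseteq> \<tau> \<longrightarrow> \<sigma> \<in> S)"

definition rank :: "nat set \<Rightarrow> nat" where
  "rank \<sigma> = card \<sigma> - 1"

definition simplices :: "nat set set \<Rightarrow> nat \<Rightarrow> nat set set" where
  "simplices S k = {\<sigma> \<in> S. rank \<sigma> = k}"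

definition complex_connected :: "nat \<Rightarrow> nat set set \<Rightarrow> bool" where
  "complex_connected n S \<longleftrightarrow>
     (\<forall>u\<in>{1..n}. \<forall>v\<in>{1..n}. (u, v) \<in> {(i, j). {i, j} \<in> simplices S 1}\<^sup>*)"

text \<open>The groups of an amalgam share one ambient type but are otherwise unrelated: each has its
  own carrier and multiplication. \<open>mor A \<sigma> \<tau>\<close>, for \<open>\<sigma> \<subseteq> \<tau>\<close>, is the map
  \<open>grp A \<tau> \<rightarrow> grp A \<sigma>\<close>, which is written with upper index \<open>\<sigma>\<close> and lower index \<open>\<tau>\<close> on paper.\<close>

record 'a amalgam =
  grp :: "nat set \<Rightarrow> 'a monoid"
  mor :: "nat set \<Rightarrow> nat set \<Rightarrow> 'a \<Rightarrow> 'a"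

definition simplicial_amalgam :: "nat set set \<Rightarrow> 'a amalgam \<Rightarrow> bool" where
  "simplicial_amalgam S A \<longleftrightarrow>
     (\<forall>\<sigma>\<in>S. group (grp A \<sigma>)) \<and>
     (\<forall>\<sigma>\<in>S. \<forall>\<tau>\<in>S. \<sigma> \<subseteq> \<tau> \<longrightarrow> mor A \<sigma> \<tau> \<in> mon (grp A \<tau>) (grp A \<sigma>)) \<and>
     (\<forall>\<sigma>\<in>S. \<forall>\<rho>\<in>S. \<forall>\<tau>\<in>S. \<sigma> \<subseteq> \<rho> \<and> \<rho> \<subseteq> \<tau> \<longrightarrow>
        (\<forall>x\<in>carrier (grp A \<tau>). mor A \<sigma> \<rho> (mor A \<rho> \<tau> x) = mor A \<sigma> \<tau> x))"

definition amalgam_isomorphism ::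
  "nat set set \<Rightarrow> 'a amalgam \<Rightarrow> 'a amalgam \<Rightarrow> (nat set \<Rightarrow> 'a \<Rightarrow> 'a) \<Rightarrow> bool" where
  "amalgam_isomorphism S A B \<phi> \<longleftrightarrow>
     (\<forall>\<sigma>\<in>S. \<phi> \<sigma> \<in> iso (grp A \<sigma>) (grp B \<sigma>)) \<and>
     (\<forall>\<sigma>\<in>S. \<forall>\<tau>\<in>S. \<sigma> \<subseteq> \<tau> \<longrightarrow>
        (\<forall>x\<in>carrier (grp A \<tau>). \<phi> \<sigma> (mor A \<sigma> \<tau> x) = mor B \<sigma> \<tau> (\<phi> \<tau> x)))"

definition amalgam_isomorphic :: "nat set set \<Rightarrow> 'a amalgam \<Rightarrow> 'a amalgam \<Rightarrow> bool" where
  "amalgam_isomorphic S A B \<longleftrightarrow> (\<exists>\<phi>. amalgam_isomorphism S A B \<phi>)"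

definition subgrp :: "'a amalgam \<Rightarrow> nat set \<Rightarrow> nat set \<Rightarrow> 'a set" where
  "subgrp G\<^sub>0 \<sigma> \<tau> = mor G\<^sub>0 \<sigma> \<tau> ` carrier (grp G\<^sub>0 \<tau>)"

text \<open>The last two conditions only fix the irrelevant values of the maps (outside the carriers, and
  at indices that are not pairs of nested simplices), so that every amalgam of the given type is
  represented by exactly one term.\<close>

definition amalgams_of_type :: "nat set set \<Rightarrow> 'a amalgam \<Rightarrow> 'a amalgam set" where
  "amalgams_of_type S G\<^sub>0 = {A.
     simplicial_amalgam S A \<and>
     grp A = grp G\<^sub>0 \<and>
     (\<forall>\<sigma>\<in>S. \<forall>\<tau>\<in>S. \<sigma> \<subseteq> \<tau> \<longrightarrow> mor A \<sigma> \<tau> ` carrier (grp A \<tau>) = subgrp G\<^sub>0 \<sigma> \<tau>) \<and>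
     (\<forall>\<sigma>\<in>S. \<forall>\<tau>\<in>S. \<sigma> \<subseteq> \<tau> \<longrightarrow> mor A \<sigma> \<tau> \<in> extensional (carrier (grp A \<tau>))) \<and>
     (\<forall>\<sigma> \<tau>. \<not> (\<sigma> \<in> S \<and> \<tau> \<in> S \<and> \<sigma> \<subseteq> \<tau>) \<longrightarrow> mor A \<sigma> \<tau> = undefined)}"

definition isomorphism_classes_of_type :: "nat set set \<Rightarrow> 'a amalgam \<Rightarrow> 'a amalgam set set" where
  "isomorphism_classes_of_type S G\<^sub>0 =
     amalgams_of_type S G\<^sub>0 //
       {(A, B). A \<in> amalgams_of_type S G\<^sub>0 \<and> B \<in> amalgams_of_type S G\<^sub>0 \<and> amalgam_isomorphic S A B}"

text \<open>The product of \<open>f\<close> and \<open>g\<close> in \<^const>\<open>AutoGroup\<close> is \<open>f \<circ> g\<close> (first \<open>g\<close>, then \<open>f\<close>).\<close>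

definition coeff_group :: "nat set set \<Rightarrow> 'a amalgam \<Rightarrow> nat set \<Rightarrow> ('a \<Rightarrow> 'a) monoid" where
  "coeff_group S G\<^sub>0 \<sigma> = (AutoGroup (grp G\<^sub>0 \<sigma>))
     \<lparr>carrier := {g \<in> carrier (AutoGroup (grp G\<^sub>0 \<sigma>)).
        \<forall>\<tau>\<in>S. \<sigma> \<subseteq> \<tau> \<longrightarrow> g ` subgrp G\<^sub>0 \<sigma> \<tau> = subgrp G\<^sub>0 \<sigma> \<tau>}\<rparr>"

definition coeff_map :: "'a amalgam \<Rightarrow> nat set \<Rightarrow> nat set \<Rightarrow> ('a \<Rightarrow> 'a) \<Rightarrow> 'a \<Rightarrow> 'a" where
  "coeff_map G\<^sub>0 \<sigma> \<tau> f = (\<lambda>x\<in>carrier (grp G\<^sub>0 \<tau>).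
     inv_into (carrier (grp G\<^sub>0 \<tau>)) (mor G\<^sub>0 \<sigma> \<tau>) (f (mor G\<^sub>0 \<sigma> \<tau> x)))"

definition cochain_group ::
  "nat set set \<Rightarrow> 'a amalgam \<Rightarrow> nat \<Rightarrow> (nat set \<Rightarrow> 'a \<Rightarrow> 'a) monoid" where
  "cochain_group S G\<^sub>0 k = product_group (simplices S k) (coeff_group S G\<^sub>0)"

definition cocycles :: "nat set set \<Rightarrow> 'a amalgam \<Rightarrow> (nat set \<Rightarrow> 'a \<Rightarrow> 'a) set" where
  "cocycles S G\<^sub>0 = {a \<in> carrier (cochain_group S G\<^sub>0 1).
     \<forall>i j k. i < j \<and> j < k \<and> {i, j, k} \<in> simplices S 2 \<longrightarrow>
       coeff_map G\<^sub>0 {j, k} {i, j, k} (inv\<^bsub>coeff_group S G\<^sub>0 {j, k}\<^esub> a {j, k})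
         \<otimes>\<^bsub>coeff_group S G\<^sub>0 {i, j, k}\<^esub> coeff_map G\<^sub>0 {i, k} {i, j, k} (a {i, k})
         \<otimes>\<^bsub>coeff_group S G\<^sub>0 {i, j, k}\<^esub>
           coeff_map G\<^sub>0 {i, j} {i, j, k} (inv\<^bsub>coeff_group S G\<^sub>0 {i, j}\<^esub> a {i, j})
       = \<one>\<^bsub>coeff_group S G\<^sub>0 {i, j, k}\<^esub>}"

text \<open>The right action of 0-cochains on 1-cochains; an edge \<open>e = {i, j}\<close> with \<open>i < j\<close> has
  \<open>i = Min e\<close> and \<open>j = Max e\<close>.\<close>

definition cochain_action ::
  "nat set set \<Rightarrow> 'a amalgam \<Rightarrow> (nat set \<Rightarrow> 'a \<Rightarrow> 'a) \<Rightarrow> (nat set \<Rightarrow> 'a \<Rightarrow> 'a)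
     \<Rightarrow> (nat set \<Rightarrow> 'a \<Rightarrow> 'a)" where
  "cochain_action S G\<^sub>0 b a = (\<lambda>e\<in>simplices S 1.
     let i = Min e; j = Max e in
       coeff_map G\<^sub>0 {j} e (inv\<^bsub>coeff_group S G\<^sub>0 {j}\<^esub> a {j})
         \<otimes>\<^bsub>coeff_group S G\<^sub>0 e\<^esub> b e
         \<otimes>\<^bsub>coeff_group S G\<^sub>0 e\<^esub> coeff_map G\<^sub>0 {i} e (a {i}))"

definition cohomology_set :: "nat set set \<Rightarrow> 'a amalgam \<Rightarrow> (nat set \<Rightarrow> 'a \<Rightarrow> 'a) set set" where
  "cohomology_set S G\<^sub>0 =
     (\<lambda>b. cochain_action S G\<^sub>0 b ` carrier (cochain_group S G\<^sub>0 0)) ` cocycles S G\<^sub>0"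

end

theory Submission
  imports Defs
begin

text \<open>Every structure map of an amalgam of type \<open>G\<^sub>0\<close> is \<open>\<psi> \<sigma> \<tau> \<circ> b \<sigma> \<tau>\<close> for a unique \<open>b \<sigma> \<tau>\<close> in the
  coefficient group \<open>C \<tau>\<close>, and the amalgam axioms become the cocycle identity
  \<open>\<alpha> \<rho> \<tau> (b \<sigma> \<rho>) \<cdot> b \<rho> \<tau> = b \<sigma> \<tau>\<close> on the poset of simplices; isomorphisms become coboundaries
  \<open>\<alpha> \<sigma> \<tau> (\<phi> \<sigma>) \<cdot> b \<sigma> \<tau> = b' \<sigma> \<tau> \<cdot> \<phi> \<tau>\<close>. The class in \<open>H\<^sup>1\<close> is that of the cochain with value
  \<open>b {j} {i, j} \<cdot> (b {i} {i, j})\<^sup>-\<^sup>1\<close> on the edge \<open>i < j\<close>. It determines \<open>b\<close> up to coboundaries because a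
  family \<open>\<phi>\<close> given on the vertices extends to every simplex \<open>\<sigma>\<close> by transport from any vertex of \<open>\<sigma>\<close>,
  and all choices of vertex agree by the identity on the edges.\<close>

section \<open>Cancellation in groups, and quotients by the kernel of a map\<close>

text \<open>With \<open>x\<close>, \<open>y\<close>, \<open>z\<close> the images of
  \<open>a {j, k}\<close>, \<open>a {i, k}\<close>, \<open>a {i, j}\<close> in the group of a
  triangle, this turns the cocycle condition into a product formula without inverses, as used in
  \<open>cocycles_iff\<close>.\<close>

lemma (in group) inv_mult_inv_eq_one_iff:
  assumes "x \<in> carrier G" "y \<in> carrier G" "z \<in> carrier G"
  shows "inv x \<otimes> y \<otimes> inv z = \<one> \<longleftrightarrow> y = x \<otimes> z"
proof -
  have "inv x \<otimes> y \<otimes> inv z = \<one> \<longleftrightarrow> inv x \<otimes> y = z"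
    using assms inv_solve_right'[of \<one> "inv x \<otimes> y" z] by auto
  also have "\<dots> \<longleftrightarrow> y = x \<otimes> z"
    using assms inv_solve_left'[of z x y] by auto
  finally show ?thesis .
qed

text \<open>Clears the inverse from the action of 0-cochains: in
  \<open>cochain_action_eq_iff\<close>, \<open>p\<close> and \<open>q\<close> are the images of the
  two vertex values, and \<open>b\<close> and \<open>c\<close> are the edge values before and after
  acting.\<close>

lemma (in group) eq_inv_mult_mult_iff:
  assumes "p \<in> carrier G" "b \<in> carrier G" "q \<in> carrier G" "c \<in> carrier G"
  shows "c = inv p \<otimes> b \<otimes> q \<longleftrightarrow> p \<otimes> c = b \<otimes> q"
  using assms inv_solve_left[of c p "b \<otimes> q"] by (auto simp: m_assoc)

text \<open>The classes of \<open>R\<close> are exactly the fibres of \<open>F\<close> on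
  \<open>X\<close>, so \<open>F\<close> induces an injective map on them. That \<open>R\<close> is
  an equivalence relation is contained in the second assumption.\<close>

lemma bij_betw_quotient_of_kernel:
  assumes F: "F ` X = Y"
    and R: "\<And>x y. (x, y) \<in> R \<longleftrightarrow> x \<in> X \<and> y \<in> X \<and> F x = F y"
  shows "\<exists>f. bij_betw f (X // R) Y"
proof
  \<comment> \<open>\<open>F\<close> is constant on each class, so the choice of representative does
    not affect the value.\<close>
  let ?f = "\<lambda>C. F (SOME x. x \<in> C)"
  have f: "?f (R `` {x}) = F x" if "x \<in> X" for x
  proof -
    have "x \<in> R `` {x}" using that R by auto
    then have "(SOME y. y \<in> R `` {x}) \<in> R `` {x}" by (rule someI)
    then show ?thesis using R by auto
  qed
  show "bij_betw ?f (X // R) Y"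
    unfolding bij_betw_def
  proof
    show "inj_on ?f (X // R)"
    proof (rule inj_onI)
      fix C D assume C: "C \<in> X // R" and D: "D \<in> X // R" and eq: "?f C = ?f D"
      obtain x y where x: "x \<in> X" "C = R `` {x}" and y: "y \<in> X" "D = R `` {y}"
        using C D by (auto simp: quotient_def)
      have "F x = F y" using eq f x y by simp
      then show "C = D" using x y R by auto
    qed
    show "?f ` (X // R) = Y"
      using f F by (force simp: quotient_def)
  qed
qed

section \<open>Simplices and the structure maps of the reference amalgam\<close>

locale amalgam_over_complex =
  fixes n :: nat and S :: "nat set set" and G\<^sub>0 :: "'a amalgam"
  assumes complex: "simplicial_complex n S"
    and amalgam: "simplicial_amalgam S G\<^sub>0"
begin

abbreviation "Gr \<sigma> \<equiv> carrier (grp G\<^sub>0 \<sigma>)"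
abbreviation "\<psi> \<equiv> mor G\<^sub>0"
abbreviation "C \<equiv> coeff_group S G\<^sub>0"
abbreviation "\<alpha> \<equiv> coeff_map G\<^sub>0"
abbreviation "face \<sigma> \<tau> \<equiv> \<sigma> \<in> S \<and> \<tau> \<in> S \<and> \<sigma> \<subseteq> \<tau>"

lemma simplex_finite: "\<sigma> \<in> S \<Longrightarrow> finite \<sigma>"
  using complex finite_subset[of \<sigma> "{1..n}"] by (simp add: simplicial_complex_def)

lemma simplex_nonempty: "\<sigma> \<in> S \<Longrightarrow> \<sigma> \<noteq> {}"
  using complex unfolding simplicial_complex_def by blast

lemma simplex_subset: "\<tau> \<in> S \<Longrightarrow> \<sigma> \<subseteq> \<tau> \<Longrightarrow> \<sigma> \<noteq> {} \<Longrightarrow> \<sigma> \<in> S"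
  using complex unfolding simplicial_complex_def by blast

lemma Min_simplex: "\<sigma> \<in> S \<Longrightarrow> Min \<sigma> \<in> \<sigma>"
  by (simp add: simplex_finite simplex_nonempty)

text \<open>Truncated subtraction gives rank 0 also to sets of \<open>card\<close> 0, that is, to
  empty and infinite sets; simplices are neither.\<close>

lemma vertices_iff: "\<sigma> \<in> simplices S 0 \<longleftrightarrow> (\<exists>v. \<sigma> = {v} \<and> {v} \<in> S)"
proof
  assume s: "\<sigma> \<in> simplices S 0"
  then have "\<sigma> \<in> S" "card \<sigma> \<le> 1" by (auto simp: simplices_def rank_def)
  then have "card \<sigma> = 1"
    using simplex_finite simplex_nonempty card_gt_0_iff[of \<sigma>] by fastforce
  then show "\<exists>v. \<sigma> = {v} \<and> {v} \<in> S" using \<open>\<sigma> \<in> S\<close> by (metis card_1_singletonE)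
qed (auto simp: simplices_def rank_def)

lemma edge_iff: "i < j \<Longrightarrow> {i, j} \<in> simplices S 1 \<longleftrightarrow> {i, j} \<in> S"
  by (auto simp: simplices_def rank_def)

lemma edgeE:
  assumes "e \<in> simplices S 1"
  obtains i j where "i < j" "e = {i, j}" "{i, j} \<in> S" "Min e = i" "Max e = j"
proof -
  have "card e = 2" "e \<in> S" using assms by (auto simp: simplices_def rank_def)
  then obtain x y where "e = {x, y}" "x \<noteq> y" by (auto simp: card_2_iff)
  then have "min x y < max x y" "e = {min x y, max x y}" by (auto simp: min_def max_def)
  then show ?thesis using \<open>e \<in> S\<close> by (intro that[of "min x y" "max x y"]) auto
qed

lemma triangle_iff: "i < j \<Longrightarrow> j < k \<Longrightarrow> {i, j, k} \<in> simplices S 2 \<longleftrightarrow> {i, j, k} \<in> S"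
  by (auto simp: simplices_def rank_def)

lemma grp_group: "\<sigma> \<in> S \<Longrightarrow> group (grp G\<^sub>0 \<sigma>)"
  using amalgam by (simp add: simplicial_amalgam_def)

lemma psi_mon: "face \<sigma> \<tau> \<Longrightarrow> \<psi> \<sigma> \<tau> \<in> mon (grp G\<^sub>0 \<tau>) (grp G\<^sub>0 \<sigma>)"
  using amalgam by (simp add: simplicial_amalgam_def)

lemma psi_hom: "face \<sigma> \<tau> \<Longrightarrow> \<psi> \<sigma> \<tau> \<in> hom (grp G\<^sub>0 \<tau>) (grp G\<^sub>0 \<sigma>)"
  using psi_mon by (auto simp: mon_def)

lemma psi_inj: "face \<sigma> \<tau> \<Longrightarrow> inj_on (\<psi> \<sigma> \<tau>) (Gr \<tau>)"
  using psi_mon by (auto simp: mon_def)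

lemma psi_closed: "face \<sigma> \<tau> \<Longrightarrow> x \<in> Gr \<tau> \<Longrightarrow> \<psi> \<sigma> \<tau> x \<in> Gr \<sigma>"
  using psi_hom by (auto simp: hom_def)

lemma psi_comp:
  "face \<sigma> \<rho> \<Longrightarrow> face \<rho> \<tau> \<Longrightarrow> x \<in> Gr \<tau> \<Longrightarrow> \<psi> \<sigma> \<rho> (\<psi> \<rho> \<tau> x) = \<psi> \<sigma> \<tau> x"
  using amalgam unfolding simplicial_amalgam_def by blast

text \<open>The definition of an amalgam does not ask for identities, but composition makes
  \<open>\<psi> \<sigma> \<sigma>\<close> idempotent, and an injective idempotent map is the
  identity.\<close>

lemma psi_self: "\<sigma> \<in> S \<Longrightarrow> x \<in> Gr \<sigma> \<Longrightarrow> \<psi> \<sigma> \<sigma> x = x"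
  using psi_comp[of \<sigma> \<sigma> \<sigma> x] psi_inj[of \<sigma> \<sigma>] psi_closed[of \<sigma> \<sigma> x]
  by (auto dest: inj_onD)

lemma psi_subgrp:
  "face \<sigma> \<rho> \<Longrightarrow> face \<rho> \<tau> \<Longrightarrow> \<psi> \<sigma> \<rho> ` subgrp G\<^sub>0 \<rho> \<tau> = subgrp G\<^sub>0 \<sigma> \<tau>"
  using psi_comp[of \<sigma> \<rho> \<tau>] by (auto simp: subgrp_def image_image cong: image_cong_simp)

lemma subgrp_subset: "face \<sigma> \<tau> \<Longrightarrow> subgrp G\<^sub>0 \<sigma> \<tau> \<subseteq> Gr \<sigma>"
  using psi_closed by (auto simp: subgrp_def)

subsection \<open>Coefficient groups\<close>

lemma coeff_carrier_iff:
  "f \<in> carrier (C \<sigma>) \<longleftrightarrow> f \<in> iso (grp G\<^sub>0 \<sigma>) (grp G\<^sub>0 \<sigma>) \<and> f \<in> extensional (Gr \<sigma>) \<and>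
     (\<forall>\<tau>\<in>S. \<sigma> \<subseteq> \<tau> \<longrightarrow> f ` subgrp G\<^sub>0 \<sigma> \<tau> = subgrp G\<^sub>0 \<sigma> \<tau>)"
  by (auto simp: coeff_group_def AutoGroup_def auto_def Bij_def iso_def)

lemma coeff_closed: "f \<in> carrier (C \<sigma>) \<Longrightarrow> x \<in> Gr \<sigma> \<Longrightarrow> f x \<in> Gr \<sigma>"
  by (auto simp: coeff_carrier_iff iso_def hom_def)

lemma coeff_eqI:
  assumes "f \<in> carrier (C \<sigma>)" "g \<in> carrier (C \<sigma>)" "\<And>x. x \<in> Gr \<sigma> \<Longrightarrow> f x = g x"
  shows "f = g"
  using assms by (intro extensionalityI[of f "Gr \<sigma>" g]) (auto simp: coeff_carrier_iff)

lemma coeff_Bij: "f \<in> carrier (C \<sigma>) \<Longrightarrow> f \<in> Bij (Gr \<sigma>)"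
  by (auto simp: coeff_carrier_iff Bij_def iso_def)

lemma coeff_mult:
  "f \<in> carrier (C \<sigma>) \<Longrightarrow> g \<in> carrier (C \<sigma>) \<Longrightarrow> x \<in> Gr \<sigma> \<Longrightarrow> (f \<otimes>\<^bsub>C \<sigma>\<^esub> g) x = f (g x)"
  using coeff_Bij[of f \<sigma>] coeff_Bij[of g \<sigma>]
  by (simp add: coeff_group_def AutoGroup_def BijGroup_def compose_def)

lemma coeff_group_group:
  assumes s: "\<sigma> \<in> S"
  shows "group (C \<sigma>)"
proof -
  let ?A = "AutoGroup (grp G\<^sub>0 \<sigma>)"
  interpret A: group ?A by (rule group.AutoGroup[OF grp_group[OF s]])
  have AB: "f \<in> Bij (Gr \<sigma>)" if "f \<in> carrier ?A" for f
    using that by (simp add: AutoGroup_def auto_def)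
  have mult: "f \<otimes>\<^bsub>?A\<^esub> g = compose (Gr \<sigma>) f g" if "f \<in> carrier ?A" "g \<in> carrier ?A" for f g
    using AB that by (simp add: AutoGroup_def BijGroup_def)
  have one: "\<one>\<^bsub>?A\<^esub> = (\<lambda>x\<in>Gr \<sigma>. x)" by (simp add: AutoGroup_def BijGroup_def)
  let ?H = "{g \<in> carrier ?A. \<forall>\<tau>\<in>S. \<sigma> \<subseteq> \<tau> \<longrightarrow> g ` subgrp G\<^sub>0 \<sigma> \<tau> = subgrp G\<^sub>0 \<sigma> \<tau>}"
  have comp_image: "compose (Gr \<sigma>) f g ` subgrp G\<^sub>0 \<sigma> \<tau> = f ` g ` subgrp G\<^sub>0 \<sigma> \<tau>"
    if "\<tau> \<in> S" "\<sigma> \<subseteq> \<tau>" for f g \<tau>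
    using subgrp_subset[of \<sigma> \<tau>] s that by (auto simp: compose_def image_image subset_iff)
  have one_image: "(\<lambda>x\<in>Gr \<sigma>. x) ` subgrp G\<^sub>0 \<sigma> \<tau> = subgrp G\<^sub>0 \<sigma> \<tau>"
    if "\<tau> \<in> S" "\<sigma> \<subseteq> \<tau>" for \<tau>
    using subgrp_subset[of \<sigma> \<tau>] s that by (auto simp: subset_iff)
  have "subgroup ?H ?A"
  proof (rule A.subgroupI)
    have "\<one>\<^bsub>?A\<^esub> \<in> ?H" using one_image one A.one_closed by simp
    then show "?H \<noteq> {}" by blast
  next
    fix f assume f: "f \<in> ?H"
    then have fA: "f \<in> carrier ?A" by simp
    have "(inv\<^bsub>?A\<^esub> f) ` subgrp G\<^sub>0 \<sigma> \<tau> = subgrp G\<^sub>0 \<sigma> \<tau>" if t: "\<tau> \<in> S" "\<sigma> \<subseteq> \<tau>" for \<tau>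
    proof -
      \<comment> \<open>Since \<open>f\<close> maps the subgroup onto itself, applying the inverse
        to its image under \<open>f\<close> is the same as applying the inverse to the
        subgroup.\<close>
      have "compose (Gr \<sigma>) (inv\<^bsub>?A\<^esub> f) f = (\<lambda>x\<in>Gr \<sigma>. x)"
        using A.l_inv[OF fA] mult[OF A.inv_closed[OF fA] fA] one by simp
      then have "(inv\<^bsub>?A\<^esub> f) ` f ` subgrp G\<^sub>0 \<sigma> \<tau> = subgrp G\<^sub>0 \<sigma> \<tau>"
        using comp_image[OF t] one_image[OF t] by metis
      then show ?thesis using f t by simp
    qed
    then show "inv\<^bsub>?A\<^esub> f \<in> ?H" using fA by simp
  next
    fix f g assume f: "f \<in> ?H" and g: "g \<in> ?H"
    then have "f \<otimes>\<^bsub>?A\<^esub> g = compose (Gr \<sigma>) f g" by (intro mult) auto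
    moreover have "compose (Gr \<sigma>) f g ` subgrp G\<^sub>0 \<sigma> \<tau> = subgrp G\<^sub>0 \<sigma> \<tau>"
      if "\<tau> \<in> S" "\<sigma> \<subseteq> \<tau>" for \<tau>
      using f g that comp_image[OF that, of f g] by simp
    ultimately show "f \<otimes>\<^bsub>?A\<^esub> g \<in> ?H"
      using f g A.m_closed[of f g] by simp
  qed blast
  then show ?thesis
    unfolding coeff_group_def by (rule A.subgroup_imp_group)
qed

text \<open>As \<open>f\<close> preserves the image of \<open>\<psi> \<sigma> \<tau>\<close>, the
  element inverted by \<open>inv_into\<close> does lie in that image. The second equation is the
  characterisation of \<open>\<alpha> \<sigma> \<tau> f\<close> through which all later computations
  go.\<close>

lemma psi_coeff_map:
  assumes "face \<sigma> \<tau>" "f \<in> carrier (C \<sigma>)" "x \<in> Gr \<tau>"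
  shows "\<alpha> \<sigma> \<tau> f x \<in> Gr \<tau>" "\<psi> \<sigma> \<tau> (\<alpha> \<sigma> \<tau> f x) = f (\<psi> \<sigma> \<tau> x)"
proof -
  have "f (\<psi> \<sigma> \<tau> x) \<in> f ` subgrp G\<^sub>0 \<sigma> \<tau>" using assms by (auto simp: subgrp_def)
  also have "\<dots> = \<psi> \<sigma> \<tau> ` Gr \<tau>" using assms by (auto simp: coeff_carrier_iff subgrp_def)
  finally have *: "f (\<psi> \<sigma> \<tau> x) \<in> \<psi> \<sigma> \<tau> ` Gr \<tau>" .
  show "\<alpha> \<sigma> \<tau> f x \<in> Gr \<tau>" "\<psi> \<sigma> \<tau> (\<alpha> \<sigma> \<tau> f x) = f (\<psi> \<sigma> \<tau> x)"
    using assms(3) inv_into_into[OF *] f_inv_into_f[OF *] by (simp_all add: coeff_map_def)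
qed

text \<open>Two cases matter: \<open>h = f \<circ> \<psi> \<sigma> \<tau>\<close> with \<open>f\<close> in the coefficient group of \<open>\<sigma>\<close>, and \<open>h\<close> a structure
  map of an amalgam of type \<open>G\<^sub>0\<close>.\<close>

lemma coeff_memI:
  assumes f: "face \<sigma> \<tau>" and h: "h \<in> mon (grp G\<^sub>0 \<tau>) (grp G\<^sub>0 \<sigma>)"
    and im: "\<And>\<rho>. face \<tau> \<rho> \<Longrightarrow> h ` subgrp G\<^sub>0 \<tau> \<rho> = subgrp G\<^sub>0 \<sigma> \<rho>"
    and g: "g \<in> extensional (Gr \<tau>)" "\<And>x. x \<in> Gr \<tau> \<Longrightarrow> g x \<in> Gr \<tau>"
      "\<And>x. x \<in> Gr \<tau> \<Longrightarrow> \<psi> \<sigma> \<tau> (g x) = h x"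
  shows "g \<in> carrier (C \<tau>)"
proof -
  interpret T: group "grp G\<^sub>0 \<tau>" using grp_group f by blast
  have hh: "h \<in> hom (grp G\<^sub>0 \<tau>) (grp G\<^sub>0 \<sigma>)" and hi: "inj_on h (Gr \<tau>)"
    using h by (auto simp: mon_def)
  have eq: "x = y" if "\<psi> \<sigma> \<tau> x = \<psi> \<sigma> \<tau> y" "x \<in> Gr \<tau>" "y \<in> Gr \<tau>" for x y
    using psi_inj[OF f] that by (auto dest: inj_onD)
  have "g \<in> hom (grp G\<^sub>0 \<tau>) (grp G\<^sub>0 \<tau>)"
  proof (rule homI)
    fix x y assume xy: "x \<in> Gr \<tau>" "y \<in> Gr \<tau>"
    show "g (x \<otimes>\<^bsub>grp G\<^sub>0 \<tau>\<^esub> y) = g x \<otimes>\<^bsub>grp G\<^sub>0 \<tau>\<^esub> g y"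
      by (rule eq) (use xy in \<open>simp_all add: g hom_mult[OF hh] hom_mult[OF psi_hom[OF f]]\<close>)
  qed (use g in auto)
  moreover have img: "g ` subgrp G\<^sub>0 \<tau> \<rho> = subgrp G\<^sub>0 \<tau> \<rho>" if r: "face \<tau> \<rho>" for \<rho>
  proof -
    have sub: "subgrp G\<^sub>0 \<tau> \<rho> \<subseteq> Gr \<tau>" using subgrp_subset r by blast
    have "\<psi> \<sigma> \<tau> ` g ` subgrp G\<^sub>0 \<tau> \<rho> = h ` subgrp G\<^sub>0 \<tau> \<rho>"
      unfolding image_image using sub g(3) by (intro image_cong) auto
    also have "\<dots> = \<psi> \<sigma> \<tau> ` subgrp G\<^sub>0 \<tau> \<rho>"
      using im[OF r] psi_subgrp[OF f r] by simp
    finally show ?thesis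
      using inj_on_image_eq_iff[OF psi_inj[OF f], of "g ` subgrp G\<^sub>0 \<tau> \<rho>"] sub g(2) by blast
  qed
  \<comment> \<open>Surjectivity is the case \<open>\<rho> = \<tau>\<close> of the previous fact,
    because \<open>\<psi> \<tau> \<tau>\<close> is the identity; injectivity is inherited from
    \<open>h\<close>, which is \<open>g\<close> followed by
    \<open>\<psi> \<sigma> \<tau>\<close>.\<close>
  moreover have "bij_betw g (Gr \<tau>) (Gr \<tau>)"
  proof -
    have "subgrp G\<^sub>0 \<tau> \<tau> = Gr \<tau>" using psi_self f by (auto simp: subgrp_def image_iff)
    then have "g ` Gr \<tau> = Gr \<tau>" using img[of \<tau>] f by simp
    moreover have "inj_on g (Gr \<tau>)"
      using hi g(3) by (metis inj_on_def)
    ultimately show ?thesis by (simp add: bij_betw_def)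
  qed
  ultimately show ?thesis using g f by (auto simp: coeff_carrier_iff iso_def)
qed

lemma coeff_map_closed:
  assumes f: "face \<sigma> \<tau>" and g: "f \<in> carrier (C \<sigma>)"
  shows "\<alpha> \<sigma> \<tau> f \<in> carrier (C \<tau>)"
proof (rule coeff_memI[OF f, where h = "f \<circ> \<psi> \<sigma> \<tau>"])
  have fh: "f \<in> hom (grp G\<^sub>0 \<sigma>) (grp G\<^sub>0 \<sigma>)" "inj_on f (Gr \<sigma>)"
    using g by (auto simp: coeff_carrier_iff iso_def bij_betw_def)
  have "inj_on f (\<psi> \<sigma> \<tau> ` Gr \<tau>)"
    using psi_closed[OF f] by (intro inj_on_subset[OF fh(2)]) auto
  then show "f \<circ> \<psi> \<sigma> \<tau> \<in> mon (grp G\<^sub>0 \<tau>) (grp G\<^sub>0 \<sigma>)"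
    using hom_compose[OF psi_hom[OF f] fh(1)] comp_inj_on[OF psi_inj[OF f]]
    by (simp add: mon_def)
  show "(f \<circ> \<psi> \<sigma> \<tau>) ` subgrp G\<^sub>0 \<tau> \<rho> = subgrp G\<^sub>0 \<sigma> \<rho>" if "face \<tau> \<rho>" for \<rho>
  proof -
    have "f ` subgrp G\<^sub>0 \<sigma> \<rho> = subgrp G\<^sub>0 \<sigma> \<rho>"
      using g f that unfolding coeff_carrier_iff by blast
    then show ?thesis
      using psi_subgrp[OF f that] by (metis image_comp)
  qed
  show "\<alpha> \<sigma> \<tau> f \<in> extensional (Gr \<tau>)" by (simp add: coeff_map_def)
qed (use psi_coeff_map[OF f g] in auto)

text \<open>Injective maps cancel on the left. Identities in \<open>C \<tau>\<close> can therefore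
  be checked inside the group of \<sigma>, where \<open>psi_coeff_map\<close> eliminates
  \<open>\<alpha> \<sigma> \<tau>\<close>.\<close>

lemma coeff_eq_psiI:
  assumes "face \<sigma> \<tau>" "f \<in> carrier (C \<tau>)" "g \<in> carrier (C \<tau>)"
    "\<And>x. x \<in> Gr \<tau> \<Longrightarrow> \<psi> \<sigma> \<tau> (f x) = \<psi> \<sigma> \<tau> (g x)"
  shows "f = g"
proof (rule coeff_eqI[OF assms(2,3)])
  fix x assume "x \<in> Gr \<tau>"
  then show "f x = g x"
    using inj_onD[OF psi_inj[OF assms(1)] assms(4)] coeff_closed assms(2,3) by blast
qed

lemma coeff_map_hom:
  assumes f: "face \<sigma> \<tau>"
  shows "\<alpha> \<sigma> \<tau> \<in> hom (C \<sigma>) (C \<tau>)"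
proof (rule homI)
  fix g h assume g: "g \<in> carrier (C \<sigma>)" and h: "h \<in> carrier (C \<sigma>)"
  interpret s: group "C \<sigma>" using coeff_group_group f by blast
  interpret t: group "C \<tau>" using coeff_group_group f by blast
  note cl = coeff_map_closed[OF f]
  show "\<alpha> \<sigma> \<tau> (g \<otimes>\<^bsub>C \<sigma>\<^esub> h) = \<alpha> \<sigma> \<tau> g \<otimes>\<^bsub>C \<tau>\<^esub> \<alpha> \<sigma> \<tau> h"
    by (rule coeff_eq_psiI[OF f])
      (use g h f cl in \<open>simp_all add: coeff_mult psi_coeff_map psi_closed\<close>)
qed (rule coeff_map_closed[OF f])

lemma coeff_map_group_hom: "face \<sigma> \<tau> \<Longrightarrow> group_hom (C \<sigma>) (C \<tau>) (\<alpha> \<sigma> \<tau>)"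
  by (simp add: group_hom_def group_hom_axioms_def coeff_group_group coeff_map_hom)

text \<open>Functoriality of the coefficient system: after applying
  \<open>\<psi> \<sigma> \<tau>\<close>, which factors through the group of \<rho>, both sides at
  \<open>x\<close> become \<open>f (\<psi> \<sigma> \<tau> x)\<close>.\<close>

lemma coeff_map_comp:
  assumes "face \<sigma> \<rho>" "face \<rho> \<tau>" "f \<in> carrier (C \<sigma>)"
  shows "\<alpha> \<rho> \<tau> (\<alpha> \<sigma> \<rho> f) = \<alpha> \<sigma> \<tau> f"
proof -
  have st: "face \<sigma> \<tau>" using assms by auto
  have cl: "\<alpha> \<sigma> \<rho> f \<in> carrier (C \<rho>)" using coeff_map_closed assms by blast
  show ?thesis
  proof (rule coeff_eq_psiI[OF st])
    fix x assume x: "x \<in> Gr \<tau>"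
    have "\<psi> \<sigma> \<tau> (\<alpha> \<rho> \<tau> (\<alpha> \<sigma> \<rho> f) x) = \<psi> \<sigma> \<rho> (\<psi> \<rho> \<tau> (\<alpha> \<rho> \<tau> (\<alpha> \<sigma> \<rho> f) x))"
      using psi_comp assms x psi_coeff_map(1)[OF _ cl] by simp
    also have "\<dots> = f (\<psi> \<sigma> \<rho> (\<psi> \<rho> \<tau> x))"
      using assms x cl by (simp add: psi_coeff_map psi_closed)
    also have "\<dots> = \<psi> \<sigma> \<tau> (\<alpha> \<sigma> \<tau> f x)"
      using assms x st by (simp add: psi_coeff_map psi_comp)
    finally show "\<psi> \<sigma> \<tau> (\<alpha> \<rho> \<tau> (\<alpha> \<sigma> \<rho> f) x) = \<psi> \<sigma> \<tau> (\<alpha> \<sigma> \<tau> f x)" .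
  qed (use assms st cl coeff_map_closed in blast)+
qed

subsection \<open>Amalgams as cocycles on the poset of simplices\<close>

lemma mor_of_type:
  assumes "A \<in> amalgams_of_type S G\<^sub>0" "face \<sigma> \<tau>"
  shows "mor A \<sigma> \<tau> \<in> mon (grp G\<^sub>0 \<tau>) (grp G\<^sub>0 \<sigma>)"
    and "mor A \<sigma> \<tau> ` Gr \<tau> = subgrp G\<^sub>0 \<sigma> \<tau>"
proof -
  have grp: "grp G\<^sub>0 = grp A" using assms(1) by (simp add: amalgams_of_type_def)
  show "mor A \<sigma> \<tau> \<in> mon (grp G\<^sub>0 \<tau>) (grp G\<^sub>0 \<sigma>)"
    using assms(2) assms(1)[unfolded amalgams_of_type_def simplicial_amalgam_def mem_Collect_eq,
        THEN conjunct1, THEN conjunct2, THEN conjunct1]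
    by (simp add: grp)
  show "mor A \<sigma> \<tau> ` Gr \<tau> = subgrp G\<^sub>0 \<sigma> \<tau>"
    using assms(2) assms(1)[unfolded amalgams_of_type_def mem_Collect_eq,
        THEN conjunct2, THEN conjunct2, THEN conjunct1]
    by (simp add: grp)
qed

lemma mor_comp_of_type:
  assumes "A \<in> amalgams_of_type S G\<^sub>0" "face \<sigma> \<rho>" "face \<rho> \<tau>" "x \<in> Gr \<tau>"
  shows "mor A \<sigma> \<rho> (mor A \<rho> \<tau> x) = mor A \<sigma> \<tau> x"
  using assms unfolding amalgams_of_type_def simplicial_amalgam_def by auto

lemma mor_closed_of_type:
  assumes "A \<in> amalgams_of_type S G\<^sub>0" "face \<sigma> \<tau>" "x \<in> Gr \<tau>"
  shows "mor A \<sigma> \<tau> x \<in> Gr \<sigma>"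
  using mor_of_type(1)[OF assms(1,2)] assms(3) by (auto simp: mon_def hom_def)

text \<open>The subgroup for \<rho> and \<tau> is also the image of
  \<open>mor A \<rho> \<tau>\<close>, so composing inside \<open>A\<close> gives the image of
  \<open>mor A \<sigma> \<tau>\<close>. This is the image condition of \<open>coeff_memI\<close> for
  the structure maps of \<open>A\<close>.\<close>

lemma mor_subgrp_of_type:
  assumes A: "A \<in> amalgams_of_type S G\<^sub>0" and f: "face \<sigma> \<rho>" "face \<rho> \<tau>"
  shows "mor A \<sigma> \<rho> ` subgrp G\<^sub>0 \<rho> \<tau> = subgrp G\<^sub>0 \<sigma> \<tau>"
proof -
  have st: "face \<sigma> \<tau>" using f by auto
  have "mor A \<sigma> \<rho> ` subgrp G\<^sub>0 \<rho> \<tau> = mor A \<sigma> \<tau> ` Gr \<tau>"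
    unfolding mor_of_type(2)[OF A f(2), symmetric] image_image
    by (intro image_cong refl mor_comp_of_type[OF A f])
  then show ?thesis using mor_of_type(2)[OF A st] by simp
qed

text \<open>The structure maps of an amalgam \<open>A\<close> of type \<open>G\<^sub>0\<close> are \<open>\<psi> \<sigma> \<tau> \<circ> twist A \<sigma> \<tau>\<close>.\<close>

definition twist :: "'a amalgam \<Rightarrow> nat set \<Rightarrow> nat set \<Rightarrow> 'a \<Rightarrow> 'a" where
  "twist A \<sigma> \<tau> = (\<lambda>x\<in>Gr \<tau>. inv_into (Gr \<tau>) (\<psi> \<sigma> \<tau>) (mor A \<sigma> \<tau> x))"

lemma psi_twist:
  assumes A: "A \<in> amalgams_of_type S G\<^sub>0" and f: "face \<sigma> \<tau>" and x: "x \<in> Gr \<tau>"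
  shows "twist A \<sigma> \<tau> x \<in> Gr \<tau>" "\<psi> \<sigma> \<tau> (twist A \<sigma> \<tau> x) = mor A \<sigma> \<tau> x"
proof -
  have *: "mor A \<sigma> \<tau> x \<in> \<psi> \<sigma> \<tau> ` Gr \<tau>"
    using mor_of_type(2)[OF A f] x unfolding subgrp_def by blast
  show "twist A \<sigma> \<tau> x \<in> Gr \<tau>" "\<psi> \<sigma> \<tau> (twist A \<sigma> \<tau> x) = mor A \<sigma> \<tau> x"
    using x inv_into_into[OF *] f_inv_into_f[OF *] by (simp_all add: twist_def)
qed

lemma twist_closed:
  assumes A: "A \<in> amalgams_of_type S G\<^sub>0" and f: "face \<sigma> \<tau>"
  shows "twist A \<sigma> \<tau> \<in> carrier (C \<tau>)"
proof (rule coeff_memI[OF f mor_of_type(1)[OF A f]])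
  show "mor A \<sigma> \<tau> ` subgrp G\<^sub>0 \<tau> \<rho> = subgrp G\<^sub>0 \<sigma> \<rho>" if "face \<tau> \<rho>" for \<rho>
    by (rule mor_subgrp_of_type[OF A f that])
  show "twist A \<sigma> \<tau> \<in> extensional (Gr \<tau>)" by (simp add: twist_def)
qed (use psi_twist[OF A f] in auto)

text \<open>A non-abelian 1-cocycle on the order complex of the face poset; the value at a nested
  pair lies in the group of the larger simplex. Values at other pairs are left arbitrary.\<close>

definition poset_cocycle :: "(nat set \<Rightarrow> nat set \<Rightarrow> 'a \<Rightarrow> 'a) \<Rightarrow> bool" where
  "poset_cocycle b \<longleftrightarrow>
     (\<forall>\<sigma> \<tau>. face \<sigma> \<tau> \<longrightarrow> b \<sigma> \<tau> \<in> carrier (C \<tau>)) \<and>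
     (\<forall>\<sigma> \<rho> \<tau>. face \<sigma> \<rho> \<and> face \<rho> \<tau> \<longrightarrow> \<alpha> \<rho> \<tau> (b \<sigma> \<rho>) \<otimes>\<^bsub>C \<tau>\<^esub> b \<rho> \<tau> = b \<sigma> \<tau>)"

lemma poset_cocycle_closed: "poset_cocycle b \<Longrightarrow> face \<sigma> \<tau> \<Longrightarrow> b \<sigma> \<tau> \<in> carrier (C \<tau>)"
  by (simp add: poset_cocycle_def)

lemma poset_cocycle_comp:
  "poset_cocycle b \<Longrightarrow> face \<sigma> \<rho> \<Longrightarrow> face \<rho> \<tau> \<Longrightarrow> \<alpha> \<rho> \<tau> (b \<sigma> \<rho>) \<otimes>\<^bsub>C \<tau>\<^esub> b \<rho> \<tau> = b \<sigma> \<tau>"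
  unfolding poset_cocycle_def by blast

text \<open>Under \<open>\<psi> \<sigma> \<tau>\<close> the left-hand side becomes
  \<open>mor A \<sigma> \<rho>\<close> after \<open>mor A \<rho> \<tau>\<close>: moving
  \<open>\<psi> \<rho> \<tau>\<close> past the twist of \<sigma> and \<rho> is what introduces
  \<open>\<alpha> \<rho> \<tau>\<close>. The identity is thus the composition law of
  \<open>A\<close>.\<close>

lemma poset_cocycle_twist:
  assumes A: "A \<in> amalgams_of_type S G\<^sub>0"
  shows "poset_cocycle (twist A)"
  unfolding poset_cocycle_def
proof (intro conjI allI impI)
  fix \<sigma> \<rho> \<tau> assume "face \<sigma> \<rho> \<and> face \<rho> \<tau>"
  then have f: "face \<sigma> \<rho>" "face \<rho> \<tau>" "face \<sigma> \<tau>" by auto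
  interpret t: group "C \<tau>" using coeff_group_group f by blast
  note b = twist_closed[OF A f(1)] twist_closed[OF A f(2)] twist_closed[OF A f(3)]
  note ab = coeff_map_closed[OF f(2) b(1)]
  show "\<alpha> \<rho> \<tau> (twist A \<sigma> \<rho>) \<otimes>\<^bsub>C \<tau>\<^esub> twist A \<rho> \<tau> = twist A \<sigma> \<tau>"
  proof (rule coeff_eq_psiI[OF f(3)])
    fix x assume x: "x \<in> Gr \<tau>"
    note bx = psi_twist(1)[OF A f(2) x]
    have "\<psi> \<sigma> \<tau> ((\<alpha> \<rho> \<tau> (twist A \<sigma> \<rho>) \<otimes>\<^bsub>C \<tau>\<^esub> twist A \<rho> \<tau>) x)
        = \<psi> \<sigma> \<rho> (\<psi> \<rho> \<tau> (\<alpha> \<rho> \<tau> (twist A \<sigma> \<rho>) (twist A \<rho> \<tau> x)))"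
      using psi_comp[OF f(1,2) psi_coeff_map(1)[OF f(2) b(1) bx]] coeff_mult[OF ab b(2) x] by simp
    also have "\<dots> = mor A \<sigma> \<tau> x"
      using psi_coeff_map(2)[OF f(2) b(1) bx] psi_twist(2)[OF A f(2) x]
        psi_twist(2)[OF A f(1) mor_closed_of_type[OF A f(2) x]] mor_comp_of_type[OF A f(1,2) x]
      by simp
    finally show "\<psi> \<sigma> \<tau> ((\<alpha> \<rho> \<tau> (twist A \<sigma> \<rho>) \<otimes>\<^bsub>C \<tau>\<^esub> twist A \<rho> \<tau>) x)
        = \<psi> \<sigma> \<tau> (twist A \<sigma> \<tau> x)"
      using psi_twist(2)[OF A f(3) x] by simp
  qed (use b ab in auto)
qed (use twist_closed[OF A] in blast)

text \<open>The same computation read backwards: the maps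
  \<open>\<psi> \<sigma> \<tau> \<circ> b \<sigma> \<tau>\<close> compose correctly because of the
  cocycle identity, and have the prescribed images because each \<open>b \<sigma> \<tau>\<close> is
  an automorphism.\<close>

lemma ex_amalgam_of_poset_cocycle:
  assumes b: "poset_cocycle b"
  shows "\<exists>A\<in>amalgams_of_type S G\<^sub>0. \<forall>\<sigma> \<tau>. face \<sigma> \<tau> \<longrightarrow> twist A \<sigma> \<tau> = b \<sigma> \<tau>"
proof -
  \<comment> \<open>The restriction to carriers and the value \<open>undefined\<close> off nested
    pairs are the normalisations that \<open>amalgams_of_type\<close> demands.\<close>
  define A :: "'a amalgam" where "A = \<lparr>grp = grp G\<^sub>0, mor = (\<lambda>\<sigma> \<tau>.
    if face \<sigma> \<tau> then \<lambda>x\<in>Gr \<tau>. \<psi> \<sigma> \<tau> (b \<sigma> \<tau> x) else undefined)\<rparr>"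
  have grpA: "grp A = grp G\<^sub>0" by (simp add: A_def)
  have morA: "mor A \<sigma> \<tau> = (\<lambda>x\<in>Gr \<tau>. \<psi> \<sigma> \<tau> (b \<sigma> \<tau> x))" if "face \<sigma> \<tau>" for \<sigma> \<tau>
    using that by (simp add: A_def)
  have bc: "b \<sigma> \<tau> \<in> carrier (C \<tau>)" if "face \<sigma> \<tau>" for \<sigma> \<tau>
    using poset_cocycle_closed[OF b that] .
  have bx: "b \<sigma> \<tau> x \<in> Gr \<tau>" if "face \<sigma> \<tau>" "x \<in> Gr \<tau>" for \<sigma> \<tau> x
    using coeff_closed[OF bc[OF that(1)] that(2)] .
  have mon: "mor A \<sigma> \<tau> \<in> mon (grp G\<^sub>0 \<tau>) (grp G\<^sub>0 \<sigma>)" if f: "face \<sigma> \<tau>" for \<sigma> \<tau>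
  proof -
    interpret t: group "grp G\<^sub>0 \<tau>" using grp_group f by blast
    have bh: "b \<sigma> \<tau> \<in> hom (grp G\<^sub>0 \<tau>) (grp G\<^sub>0 \<tau>)" and bi: "inj_on (b \<sigma> \<tau>) (Gr \<tau>)"
      using bc[OF f] by (auto simp: coeff_carrier_iff iso_def bij_betw_def)
    have "mor A \<sigma> \<tau> \<in> hom (grp G\<^sub>0 \<tau>) (grp G\<^sub>0 \<sigma>)"
      by (rule homI)
        (use f in \<open>simp_all add: morA bx psi_closed hom_mult[OF bh] hom_mult[OF psi_hom[OF f]]\<close>)
    moreover have "inj_on (mor A \<sigma> \<tau>) (Gr \<tau>)"
    proof (rule inj_onI)
      fix x y assume xy: "x \<in> Gr \<tau>" "y \<in> Gr \<tau>" "mor A \<sigma> \<tau> x = mor A \<sigma> \<tau> y"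
      then have "b \<sigma> \<tau> x = b \<sigma> \<tau> y"
        using inj_onD[OF psi_inj[OF f], of "b \<sigma> \<tau> x" "b \<sigma> \<tau> y"] bx[OF f] by (simp add: morA[OF f])
      then show "x = y" using inj_onD[OF bi] xy by blast
    qed
    ultimately show ?thesis by (simp add: mon_def)
  qed
  have comp: "mor A \<sigma> \<rho> (mor A \<rho> \<tau> x) = mor A \<sigma> \<tau> x"
    if f: "face \<sigma> \<rho>" "face \<rho> \<tau>" and x: "x \<in> Gr \<tau>" for \<sigma> \<rho> \<tau> x
  proof -
    have st: "face \<sigma> \<tau>" using f by auto
    note ab = coeff_map_closed[OF f(2) bc[OF f(1)]]
    note y = bx[OF f(2) x]
    have "mor A \<sigma> \<rho> (mor A \<rho> \<tau> x) = \<psi> \<sigma> \<rho> (b \<sigma> \<rho> (\<psi> \<rho> \<tau> (b \<rho> \<tau> x)))"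
      using psi_closed[OF f(2) y] x by (simp add: morA[OF f(1)] morA[OF f(2)])
    also have "\<dots> = \<psi> \<sigma> \<rho> (\<psi> \<rho> \<tau> (\<alpha> \<rho> \<tau> (b \<sigma> \<rho>) (b \<rho> \<tau> x)))"
      using psi_coeff_map(2)[OF f(2) bc[OF f(1)] y] by simp
    also have "\<dots> = \<psi> \<sigma> \<tau> (\<alpha> \<rho> \<tau> (b \<sigma> \<rho>) (b \<rho> \<tau> x))"
      by (rule psi_comp[OF f psi_coeff_map(1)[OF f(2) bc[OF f(1)] y]])
    also have "\<dots> = \<psi> \<sigma> \<tau> (b \<sigma> \<tau> x)"
      using coeff_mult[OF ab bc[OF f(2)] x] poset_cocycle_comp[OF b f] by simp
    finally show ?thesis using x by (simp add: morA[OF st])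
  qed
  have img: "mor A \<sigma> \<tau> ` Gr \<tau> = subgrp G\<^sub>0 \<sigma> \<tau>" if f: "face \<sigma> \<tau>" for \<sigma> \<tau>
  proof -
    have "b \<sigma> \<tau> ` Gr \<tau> = Gr \<tau>"
      using bc[OF f] by (auto simp: coeff_carrier_iff iso_def bij_betw_def)
    then show ?thesis
      unfolding morA[OF f] subgrp_def by (metis image_image image_restrict_eq)
  qed
  have "A \<in> amalgams_of_type S G\<^sub>0"
    unfolding amalgams_of_type_def simplicial_amalgam_def mem_Collect_eq
  proof (intro conjI ballI allI impI)
    fix \<sigma> assume "\<sigma> \<in> S" then show "group (grp A \<sigma>)" using grp_group grpA by simp
  next
    fix \<sigma> \<tau> assume "\<sigma> \<in> S" "\<tau> \<in> S" "\<sigma> \<subseteq> \<tau>"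
    then have f: "face \<sigma> \<tau>" by simp
    show "mor A \<sigma> \<tau> \<in> mon (grp A \<tau>) (grp A \<sigma>)" using mon[OF f] grpA by simp
    show "mor A \<sigma> \<tau> ` carrier (grp A \<tau>) = subgrp G\<^sub>0 \<sigma> \<tau>" using img[OF f] grpA by simp
    show "mor A \<sigma> \<tau> \<in> extensional (carrier (grp A \<tau>))" using morA[OF f] grpA by simp
  next
    fix \<sigma> \<rho> \<tau> x
    assume "\<sigma> \<in> S" "\<rho> \<in> S" "\<tau> \<in> S" "\<sigma> \<subseteq> \<rho> \<and> \<rho> \<subseteq> \<tau>" "x \<in> carrier (grp A \<tau>)"
    then show "mor A \<sigma> \<rho> (mor A \<rho> \<tau> x) = mor A \<sigma> \<tau> x" using grpA by (intro comp) auto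
  next
    fix \<sigma> \<tau> assume "\<not> (\<sigma> \<in> S \<and> \<tau> \<in> S \<and> \<sigma> \<subseteq> \<tau>)"
    then show "mor A \<sigma> \<tau> = undefined" unfolding A_def by auto
  qed (rule grpA)
  moreover have "twist A \<sigma> \<tau> = b \<sigma> \<tau>" if f: "face \<sigma> \<tau>" for \<sigma> \<tau>
  proof (rule coeff_eqI)
    show "twist A \<sigma> \<tau> \<in> carrier (C \<tau>)" using twist_closed[OF _ f] calculation .
    show "twist A \<sigma> \<tau> x = b \<sigma> \<tau> x" if x: "x \<in> Gr \<tau>" for x
      using inv_into_f_f[OF psi_inj[OF f] bx[OF f x]] x by (simp add: twist_def morA[OF f])
  qed (rule bc[OF f])
  ultimately show ?thesis by blast
qed

section \<open>Isomorphisms as coboundaries\<close>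

text \<open>The components of an isomorphism lie in the coefficient groups: the commuting squares
  carry the image of \<open>mor A \<sigma> \<tau>\<close> to that of
  \<open>mor B \<sigma> \<tau>\<close>, and both images are
  \<open>subgrp G\<^sub>0 \<sigma> \<tau>\<close>. The squares themselves, pulled back along the
  injective \<open>\<psi> \<sigma> \<tau>\<close>, are the coboundary equations.\<close>

lemma amalgam_isomorphic_iff:
  assumes A: "A \<in> amalgams_of_type S G\<^sub>0" and B: "B \<in> amalgams_of_type S G\<^sub>0"
  shows "amalgam_isomorphic S A B \<longleftrightarrow>
    (\<exists>\<phi>. (\<forall>\<sigma>\<in>S. \<phi> \<sigma> \<in> carrier (C \<sigma>)) \<and>
      (\<forall>\<sigma> \<tau>. face \<sigma> \<tau> \<longrightarrow> \<alpha> \<sigma> \<tau> (\<phi> \<sigma>) \<otimes>\<^bsub>C \<tau>\<^esub> twist A \<sigma> \<tau> = twist B \<sigma> \<tau> \<otimes>\<^bsub>C \<tau>\<^esub> \<phi> \<tau>))"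
    (is "_ \<longleftrightarrow> (\<exists>\<phi>. ?P \<phi>)")
proof -
  have grp: "grp A = grp G\<^sub>0" "grp B = grp G\<^sub>0" using A B by (auto simp: amalgams_of_type_def)
  have square: "\<alpha> \<sigma> \<tau> (\<phi> \<sigma>) \<otimes>\<^bsub>C \<tau>\<^esub> twist A \<sigma> \<tau> = twist B \<sigma> \<tau> \<otimes>\<^bsub>C \<tau>\<^esub> \<phi> \<tau> \<longleftrightarrow>
      (\<forall>x\<in>Gr \<tau>. \<phi> \<sigma> (mor A \<sigma> \<tau> x) = mor B \<sigma> \<tau> (\<phi> \<tau> x))"
    if \<phi>: "\<And>\<sigma>. \<sigma> \<in> S \<Longrightarrow> \<phi> \<sigma> \<in> carrier (C \<sigma>)" and f: "face \<sigma> \<tau>" for \<phi> \<sigma> \<tau>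
  proof -
    interpret t: group "C \<tau>" using coeff_group_group f by blast
    have s: "\<phi> \<sigma> \<in> carrier (C \<sigma>)" and t: "\<phi> \<tau> \<in> carrier (C \<tau>)" using \<phi> f by auto
    note as = coeff_map_closed[OF f s]
    note ab = twist_closed[OF A f] twist_closed[OF B f]
    let ?l = "\<alpha> \<sigma> \<tau> (\<phi> \<sigma>) \<otimes>\<^bsub>C \<tau>\<^esub> twist A \<sigma> \<tau>" and ?r = "twist B \<sigma> \<tau> \<otimes>\<^bsub>C \<tau>\<^esub> \<phi> \<tau>"
    have l: "\<psi> \<sigma> \<tau> (?l x) = \<phi> \<sigma> (mor A \<sigma> \<tau> x)" if x: "x \<in> Gr \<tau>" for x
      using coeff_mult[OF as ab(1) x] psi_coeff_map(2)[OF f s psi_twist(1)[OF A f x]]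
        psi_twist(2)[OF A f x] by simp
    have r: "\<psi> \<sigma> \<tau> (?r x) = mor B \<sigma> \<tau> (\<phi> \<tau> x)" if x: "x \<in> Gr \<tau>" for x
      using coeff_mult[OF ab(2) t x] psi_twist(2)[OF B f coeff_closed[OF t x]] by simp
    show ?thesis
    proof
      assume "?l = ?r" then show "\<forall>x\<in>Gr \<tau>. \<phi> \<sigma> (mor A \<sigma> \<tau> x) = mor B \<sigma> \<tau> (\<phi> \<tau> x)"
        using l r by metis
    next
      assume "\<forall>x\<in>Gr \<tau>. \<phi> \<sigma> (mor A \<sigma> \<tau> x) = mor B \<sigma> \<tau> (\<phi> \<tau> x)"
      then show "?l = ?r"
        using l r as ab t by (intro coeff_eq_psiI[OF f]) auto
    qed
  qed
  show ?thesis
  proof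
    assume "amalgam_isomorphic S A B"
    then obtain \<phi> where "amalgam_isomorphism S A B \<phi>" by (auto simp: amalgam_isomorphic_def)
    then have iso: "\<And>\<sigma>. \<sigma> \<in> S \<Longrightarrow> \<phi> \<sigma> \<in> iso (grp G\<^sub>0 \<sigma>) (grp G\<^sub>0 \<sigma>)"
      and sq: "\<And>\<sigma> \<tau> x. face \<sigma> \<tau> \<Longrightarrow> x \<in> Gr \<tau> \<Longrightarrow> \<phi> \<sigma> (mor A \<sigma> \<tau> x) = mor B \<sigma> \<tau> (\<phi> \<tau> x)"
      by (auto simp: amalgam_isomorphism_def grp)
    have onto: "\<phi> \<sigma> ` Gr \<sigma> = Gr \<sigma>" if "\<sigma> \<in> S" for \<sigma>
      using iso[OF that] by (simp add: iso_def bij_betw_def)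
    \<comment> \<open>Components of an isomorphism are unconstrained off the carriers, whereas
      elements of \<open>C \<sigma>\<close> are extensional.\<close>
    define \<phi>' where "\<phi>' \<sigma> = restrict (\<phi> \<sigma>) (Gr \<sigma>)" for \<sigma>
    have \<phi>': "\<phi>' \<sigma> \<in> carrier (C \<sigma>)" if s: "\<sigma> \<in> S" for \<sigma>
      unfolding coeff_carrier_iff
    proof (intro conjI ballI impI)
      interpret s: group "grp G\<^sub>0 \<sigma>" by (rule grp_group[OF s])
      show "\<phi>' \<sigma> \<in> iso (grp G\<^sub>0 \<sigma>) (grp G\<^sub>0 \<sigma>)"
        using iso[OF s] s.hom_restrict[of "\<phi> \<sigma>" "grp G\<^sub>0 \<sigma>" "\<phi>' \<sigma>"]
        by (simp add: \<phi>'_def iso_def bij_betw_def inj_on_restrict_eq)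
      show "\<phi>' \<sigma> \<in> extensional (Gr \<sigma>)" by (simp add: \<phi>'_def)
      fix \<tau> assume "\<tau> \<in> S" "\<sigma> \<subseteq> \<tau>"
      then have f: "face \<sigma> \<tau>" using s by simp
      have "\<phi>' \<sigma> ` subgrp G\<^sub>0 \<sigma> \<tau> = \<phi> \<sigma> ` subgrp G\<^sub>0 \<sigma> \<tau>"
        using subgrp_subset[OF f] by (intro image_cong) (auto simp: \<phi>'_def)
      also have "\<dots> = (\<lambda>x. mor B \<sigma> \<tau> (\<phi> \<tau> x)) ` Gr \<tau>"
        using sq[OF f] unfolding mor_of_type(2)[OF A f, symmetric] image_image
        by (rule image_cong[OF refl])
      also have "\<dots> = mor B \<sigma> \<tau> ` \<phi> \<tau> ` Gr \<tau>" by (simp add: image_image)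
      also have "\<dots> = subgrp G\<^sub>0 \<sigma> \<tau>" using onto mor_of_type(2)[OF B f] f by simp
      finally show "\<phi>' \<sigma> ` subgrp G\<^sub>0 \<sigma> \<tau> = subgrp G\<^sub>0 \<sigma> \<tau>" .
    qed
    have "?P \<phi>'"
    proof (intro conjI ballI allI impI \<phi>')
      fix \<sigma> \<tau> assume f: "face \<sigma> \<tau>"
      show "\<alpha> \<sigma> \<tau> (\<phi>' \<sigma>) \<otimes>\<^bsub>C \<tau>\<^esub> twist A \<sigma> \<tau> = twist B \<sigma> \<tau> \<otimes>\<^bsub>C \<tau>\<^esub> \<phi>' \<tau>"
        using sq[OF f] mor_closed_of_type[OF A f]
        by (intro square[of \<phi>', THEN iffD2] \<phi>' f) (simp_all add: \<phi>'_def)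
    qed
    then show "\<exists>\<phi>. ?P \<phi>" by blast
  next
    assume "\<exists>\<phi>. ?P \<phi>"
    then obtain \<phi> where \<phi>: "\<And>\<sigma>. \<sigma> \<in> S \<Longrightarrow> \<phi> \<sigma> \<in> carrier (C \<sigma>)"
      and eq: "\<And>\<sigma> \<tau>. face \<sigma> \<tau> \<Longrightarrow> \<alpha> \<sigma> \<tau> (\<phi> \<sigma>) \<otimes>\<^bsub>C \<tau>\<^esub> twist A \<sigma> \<tau> = twist B \<sigma> \<tau> \<otimes>\<^bsub>C \<tau>\<^esub> \<phi> \<tau>"
      by blast
    have "amalgam_isomorphism S A B \<phi>"
      unfolding amalgam_isomorphism_def grp
    proof (intro conjI ballI impI)
      show "\<phi> \<sigma> \<in> iso (grp G\<^sub>0 \<sigma>) (grp G\<^sub>0 \<sigma>)" if "\<sigma> \<in> S" for \<sigma>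
        using \<phi>[OF that] by (simp add: coeff_carrier_iff)
      show "\<phi> \<sigma> (mor A \<sigma> \<tau> x) = mor B \<sigma> \<tau> (\<phi> \<tau> x)"
        if "\<sigma> \<in> S" "\<tau> \<in> S" "\<sigma> \<subseteq> \<tau>" "x \<in> Gr \<tau>" for \<sigma> \<tau> x
        using square[of \<phi> \<sigma> \<tau>, OF \<phi>] eq[of \<sigma> \<tau>] that by simp
    qed
    then show "amalgam_isomorphic S A B" by (auto simp: amalgam_isomorphic_def)
  qed
qed

subsection \<open>Orbits of cochains\<close>

lemma cochain_carrier: "carrier (cochain_group S G\<^sub>0 k) = (\<Pi>\<^sub>E \<sigma>\<in>simplices S k. carrier (C \<sigma>))"
  by (simp add: cochain_group_def)

lemma cochain_closed:
  "a \<in> carrier (cochain_group S G\<^sub>0 k) \<Longrightarrow> \<sigma> \<in> simplices S k \<Longrightarrow> a \<sigma> \<in> carrier (C \<sigma>)"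
  by (auto simp: cochain_carrier)

lemma cochain_eqI:
  "a \<in> carrier (cochain_group S G\<^sub>0 k) \<Longrightarrow> b \<in> carrier (cochain_group S G\<^sub>0 k) \<Longrightarrow>
    (\<And>\<sigma>. \<sigma> \<in> simplices S k \<Longrightarrow> a \<sigma> = b \<sigma>) \<Longrightarrow> a = b"
  unfolding cochain_carrier by (rule PiE_ext)

lemma cochain_group_group: "group (cochain_group S G\<^sub>0 k)"
  unfolding cochain_group_def
  by (rule product_group) (auto simp: simplices_def intro: coeff_group_group)

lemma edge_faces:
  assumes "i < j" "{i, j} \<in> S"
  shows "face {i} {i, j}" "face {j} {i, j}" "{i} \<in> simplices S 0" "{j} \<in> simplices S 0"
    "{i, j} \<in> simplices S 1" "Min {i, j} = i" "Max {i, j} = j"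
  using assms simplex_subset[OF assms(2)] by (auto simp: vertices_iff edge_iff simp del: One_nat_def)

lemma cochain_action_closed:
  assumes c: "c \<in> carrier (cochain_group S G\<^sub>0 1)" and a: "a \<in> carrier (cochain_group S G\<^sub>0 0)"
  shows "cochain_action S G\<^sub>0 c a \<in> carrier (cochain_group S G\<^sub>0 1)"
  unfolding cochain_carrier cochain_action_def
proof (rule restrict_PiE_iff[THEN iffD2], rule ballI)
  fix e assume e: "e \<in> simplices S 1"
  then obtain i j where ij: "i < j" "e = {i, j}" "{i, j} \<in> S" by (rule edgeE)
  note f = edge_faces[OF ij(1,3)]
  interpret e: group "C {i, j}" using coeff_group_group ij by blast
  interpret j: group_hom "C {j}" "C {i, j}" "\<alpha> {j} {i, j}" by (rule coeff_map_group_hom[OF f(2)])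
  interpret i: group_hom "C {i}" "C {i, j}" "\<alpha> {i} {i, j}" by (rule coeff_map_group_hom[OF f(1)])
  have "a {i} \<in> carrier (C {i})" "a {j} \<in> carrier (C {j})" "c {i, j} \<in> carrier (C {i, j})"
    using cochain_closed a c f by blast+
  then show "(let i = Min e; j = Max e in \<alpha> {j} e (inv\<^bsub>C {j}\<^esub> a {j}) \<otimes>\<^bsub>C e\<^esub> c e \<otimes>\<^bsub>C e\<^esub> \<alpha> {i} e (a {i}))
      \<in> carrier (C e)"
    unfolding ij(2) f(6,7) by (simp add: Let_def)
qed

text \<open>Replaces the action by commuting squares over the edges, so that later arguments can
  paste and push forward equations instead of handling inverses.\<close>

lemma cochain_action_eq_iff:
  assumes c: "c \<in> carrier (cochain_group S G\<^sub>0 1)" and a: "a \<in> carrier (cochain_group S G\<^sub>0 0)"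
    and d: "d \<in> carrier (cochain_group S G\<^sub>0 1)"
  shows "d = cochain_action S G\<^sub>0 c a \<longleftrightarrow>
    (\<forall>i j. i < j \<longrightarrow> {i, j} \<in> S \<longrightarrow>
      \<alpha> {j} {i, j} (a {j}) \<otimes>\<^bsub>C {i, j}\<^esub> d {i, j} = c {i, j} \<otimes>\<^bsub>C {i, j}\<^esub> \<alpha> {i} {i, j} (a {i}))"
    (is "_ \<longleftrightarrow> (\<forall>i j. _ \<longrightarrow> _ \<longrightarrow> ?R i j)")
proof -
  have key: "d {i, j} = cochain_action S G\<^sub>0 c a {i, j} \<longleftrightarrow> ?R i j" if ij: "i < j" "{i, j} \<in> S" for i j
  proof -
    let ?e = "{i, j}"
    note f = edge_faces[OF ij]
    interpret e: group "C ?e" using coeff_group_group f by blast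
    interpret j: group_hom "C {j}" "C ?e" "\<alpha> {j} ?e" using coeff_map_group_hom f by blast
    interpret i: group_hom "C {i}" "C ?e" "\<alpha> {i} ?e" using coeff_map_group_hom f by blast
    have m: "a {i} \<in> carrier (C {i})" "a {j} \<in> carrier (C {j})"
      "c ?e \<in> carrier (C ?e)" "d ?e \<in> carrier (C ?e)"
      using cochain_closed a c d f by blast+
    have "cochain_action S G\<^sub>0 c a ?e
        = inv\<^bsub>C ?e\<^esub> (\<alpha> {j} ?e (a {j})) \<otimes>\<^bsub>C ?e\<^esub> c ?e \<otimes>\<^bsub>C ?e\<^esub> \<alpha> {i} ?e (a {i})"
      using f m by (simp add: cochain_action_def Let_def)
    then show ?thesis using m by (simp add: e.eq_inv_mult_mult_iff)
  qed
  show ?thesis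
  proof
    assume "d = cochain_action S G\<^sub>0 c a"
    then show "\<forall>i j. i < j \<longrightarrow> {i, j} \<in> S \<longrightarrow> ?R i j" using key by blast
  next
    assume R: "\<forall>i j. i < j \<longrightarrow> {i, j} \<in> S \<longrightarrow> ?R i j"
    show "d = cochain_action S G\<^sub>0 c a"
    proof (rule cochain_eqI[OF d cochain_action_closed[OF c a]])
      fix e assume "e \<in> simplices S 1"
      then show "d e = cochain_action S G\<^sub>0 c a e" using R key by (elim edgeE) blast
    qed
  qed
qed

lemma cochain_action_one:
  assumes c: "c \<in> carrier (cochain_group S G\<^sub>0 1)"
  shows "cochain_action S G\<^sub>0 c \<one>\<^bsub>cochain_group S G\<^sub>0 0\<^esub> = c"
proof -
  interpret K: group "cochain_group S G\<^sub>0 0" by (rule cochain_group_group)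
  have "c = cochain_action S G\<^sub>0 c \<one>\<^bsub>cochain_group S G\<^sub>0 0\<^esub>"
    unfolding cochain_action_eq_iff[OF c K.one_closed c]
  proof (intro allI impI)
    fix i j :: nat assume ij: "i < j" "{i, j} \<in> S"
    let ?e = "{i, j}"
    note f = edge_faces[OF ij]
    interpret e: group "C ?e" using coeff_group_group f by blast
    interpret j: group_hom "C {j}" "C ?e" "\<alpha> {j} ?e" using coeff_map_group_hom f by blast
    interpret i: group_hom "C {i}" "C ?e" "\<alpha> {i} ?e" using coeff_map_group_hom f by blast
    show "\<alpha> {j} ?e (\<one>\<^bsub>cochain_group S G\<^sub>0 0\<^esub> {j}) \<otimes>\<^bsub>C ?e\<^esub> c ?e
        = c ?e \<otimes>\<^bsub>C ?e\<^esub> \<alpha> {i} ?e (\<one>\<^bsub>cochain_group S G\<^sub>0 0\<^esub> {i})"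
      using f(3,4) cochain_closed[OF c f(5)] by (simp add: cochain_group_def)
  qed
  then show ?thesis by simp
qed

text \<open>The right action law: over each edge the squares for \<open>a\<close> and
  \<open>b\<close> are pasted along the intermediate cochain \<open>d\<close>.\<close>

lemma cochain_action_mult:
  assumes c: "c \<in> carrier (cochain_group S G\<^sub>0 1)"
    and a: "a \<in> carrier (cochain_group S G\<^sub>0 0)" and b: "b \<in> carrier (cochain_group S G\<^sub>0 0)"
  shows "cochain_action S G\<^sub>0 (cochain_action S G\<^sub>0 c a) b
    = cochain_action S G\<^sub>0 c (a \<otimes>\<^bsub>cochain_group S G\<^sub>0 0\<^esub> b)"
proof -
  interpret K: group "cochain_group S G\<^sub>0 0" by (rule cochain_group_group)
  define d where "d = cochain_action S G\<^sub>0 c a"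
  define d' where "d' = cochain_action S G\<^sub>0 d b"
  have d: "d \<in> carrier (cochain_group S G\<^sub>0 1)"
    unfolding d_def by (rule cochain_action_closed[OF c a])
  have d': "d' \<in> carrier (cochain_group S G\<^sub>0 1)"
    unfolding d'_def by (rule cochain_action_closed[OF d b])
  have "d' = cochain_action S G\<^sub>0 c (a \<otimes>\<^bsub>cochain_group S G\<^sub>0 0\<^esub> b)"
    unfolding cochain_action_eq_iff[OF c K.m_closed[OF a b] d']
  proof (intro allI impI)
    fix i j :: nat assume ij: "i < j" "{i, j} \<in> S"
    let ?e = "{i, j}"
    note f = edge_faces[OF ij]
    interpret e: group "C ?e" using coeff_group_group f by blast
    interpret j: group_hom "C {j}" "C ?e" "\<alpha> {j} ?e" using coeff_map_group_hom f by blast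
    interpret i: group_hom "C {i}" "C ?e" "\<alpha> {i} ?e" using coeff_map_group_hom f by blast
    have m: "a {i} \<in> carrier (C {i})" "a {j} \<in> carrier (C {j})"
      "b {i} \<in> carrier (C {i})" "b {j} \<in> carrier (C {j})"
      "c ?e \<in> carrier (C ?e)" "d ?e \<in> carrier (C ?e)" "d' ?e \<in> carrier (C ?e)"
      using cochain_closed a b c d d' f by blast+
    have ab: "(a \<otimes>\<^bsub>cochain_group S G\<^sub>0 0\<^esub> b) {i} = a {i} \<otimes>\<^bsub>C {i}\<^esub> b {i}"
      "(a \<otimes>\<^bsub>cochain_group S G\<^sub>0 0\<^esub> b) {j} = a {j} \<otimes>\<^bsub>C {j}\<^esub> b {j}"
      using f(3,4) by (simp_all add: cochain_group_def)
    have 1: "\<alpha> {j} ?e (a {j}) \<otimes>\<^bsub>C ?e\<^esub> d ?e = c ?e \<otimes>\<^bsub>C ?e\<^esub> \<alpha> {i} ?e (a {i})"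
      using cochain_action_eq_iff[OF c a d] ij by (simp add: d_def)
    have 2: "\<alpha> {j} ?e (b {j}) \<otimes>\<^bsub>C ?e\<^esub> d' ?e = d ?e \<otimes>\<^bsub>C ?e\<^esub> \<alpha> {i} ?e (b {i})"
      using cochain_action_eq_iff[OF d b d'] ij by (simp add: d'_def)
    have "\<alpha> {j} ?e (a {j} \<otimes>\<^bsub>C {j}\<^esub> b {j}) \<otimes>\<^bsub>C ?e\<^esub> d' ?e
        = \<alpha> {j} ?e (a {j}) \<otimes>\<^bsub>C ?e\<^esub> (d ?e \<otimes>\<^bsub>C ?e\<^esub> \<alpha> {i} ?e (b {i}))"
      using m by (simp add: e.m_assoc flip: 2)
    also have "\<dots> = c ?e \<otimes>\<^bsub>C ?e\<^esub> \<alpha> {i} ?e (a {i} \<otimes>\<^bsub>C {i}\<^esub> b {i})"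
      using m 1 by (simp flip: e.m_assoc)
    finally show "\<alpha> {j} ?e ((a \<otimes>\<^bsub>cochain_group S G\<^sub>0 0\<^esub> b) {j}) \<otimes>\<^bsub>C ?e\<^esub> d' ?e
        = c ?e \<otimes>\<^bsub>C ?e\<^esub> \<alpha> {i} ?e ((a \<otimes>\<^bsub>cochain_group S G\<^sub>0 0\<^esub> b) {i})"
      using ab by simp
  qed
  then show ?thesis by (simp add: d_def d'_def)
qed

abbreviation "orbit c \<equiv> cochain_action S G\<^sub>0 c ` carrier (cochain_group S G\<^sub>0 0)"

text \<open>If \<open>d\<close> arises from \<open>c\<close> by acting with \<open>a\<close>, then
  \<open>c\<close> arises from \<open>d\<close> by acting with the inverse of \<open>a\<close>; by
  the action law each orbit then contains the other.\<close>

lemma orbit_eq_iff: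
  assumes c: "c \<in> carrier (cochain_group S G\<^sub>0 1)" and d: "d \<in> carrier (cochain_group S G\<^sub>0 1)"
  shows "orbit d = orbit c \<longleftrightarrow> d \<in> orbit c"
proof
  interpret K: group "cochain_group S G\<^sub>0 0" by (rule cochain_group_group)
  have sub: "orbit (cochain_action S G\<^sub>0 x a) \<subseteq> orbit x"
    if "x \<in> carrier (cochain_group S G\<^sub>0 1)" "a \<in> carrier (cochain_group S G\<^sub>0 0)" for x a
    using cochain_action_mult that by auto
  show "d \<in> orbit c" if "orbit d = orbit c"
    using cochain_action_one[OF d] that K.one_closed by (metis imageI)
  assume "d \<in> orbit c"
  then obtain a where a: "a \<in> carrier (cochain_group S G\<^sub>0 0)" "d = cochain_action S G\<^sub>0 c a" by blast
  have "c = cochain_action S G\<^sub>0 d (inv\<^bsub>cochain_group S G\<^sub>0 0\<^esub> a)"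
    using a c by (simp add: cochain_action_mult cochain_action_one)
  then show "orbit d = orbit c"
    using sub[OF c a(1)] sub[OF d K.inv_closed[OF a(1)]] a(2) by auto
qed

subsection \<open>Restriction to edges\<close>

definition edge_cochain :: "(nat set \<Rightarrow> nat set \<Rightarrow> 'a \<Rightarrow> 'a) \<Rightarrow> nat set \<Rightarrow> 'a \<Rightarrow> 'a" where
  "edge_cochain b = (\<lambda>e\<in>simplices S 1. b {Max e} e \<otimes>\<^bsub>C e\<^esub> inv\<^bsub>C e\<^esub> b {Min e} e)"

lemma edge_cochain_closed:
  assumes b: "poset_cocycle b"
  shows "edge_cochain b \<in> carrier (cochain_group S G\<^sub>0 1)"
  unfolding cochain_carrier edge_cochain_def
proof (rule restrict_PiE_iff[THEN iffD2], rule ballI)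
  fix e assume "e \<in> simplices S 1"
  then obtain i j where ij: "i < j" "e = {i, j}" "{i, j} \<in> S" by (rule edgeE)
  note f = edge_faces[OF ij(1,3)]
  interpret e: group "C {i, j}" using coeff_group_group ij by blast
  show "b {Max e} e \<otimes>\<^bsub>C e\<^esub> inv\<^bsub>C e\<^esub> b {Min e} e \<in> carrier (C e)"
    using poset_cocycle_closed[OF b f(1)] poset_cocycle_closed[OF b f(2)]
    unfolding ij(2) f(6,7) by simp
qed

text \<open>The edge value is the transition from the vertex \<open>i\<close> to the vertex
  \<open>j\<close>, over every simplex containing both. On the edge itself this is the definition;
  pushing it to \<tau> and multiplying on the right by \<open>b {i, j} \<tau>\<close> gives the
  general case by the cocycle identity.\<close>

lemma edge_cochain_mult:
  assumes b: "poset_cocycle b" and ij: "i < j" "{i, j} \<subseteq> \<tau>" "\<tau> \<in> S"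
  shows "\<alpha> {i, j} \<tau> (edge_cochain b {i, j}) \<otimes>\<^bsub>C \<tau>\<^esub> b {i} \<tau> = b {j} \<tau>"
proof -
  let ?e = "{i, j}"
  have e: "?e \<in> S" using simplex_subset ij by blast
  note f = edge_faces[OF ij(1) e]
  have et: "face ?e \<tau>" using e ij by simp
  interpret t: group "C \<tau>" using coeff_group_group ij by blast
  interpret e: group "C ?e" using coeff_group_group e by blast
  interpret a: group_hom "C ?e" "C \<tau>" "\<alpha> ?e \<tau>" using coeff_map_group_hom et by blast
  have m: "b {i} ?e \<in> carrier (C ?e)" "b {j} ?e \<in> carrier (C ?e)" "b ?e \<tau> \<in> carrier (C \<tau>)"
    "edge_cochain b ?e \<in> carrier (C ?e)"
    by (rule poset_cocycle_closed[OF b f(1)] poset_cocycle_closed[OF b f(2)]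
        poset_cocycle_closed[OF b et] cochain_closed[OF edge_cochain_closed[OF b] f(5)])+
  have "edge_cochain b ?e = b {j} ?e \<otimes>\<^bsub>C ?e\<^esub> inv\<^bsub>C ?e\<^esub> b {i} ?e"
    using f by (simp add: edge_cochain_def)
  then have "edge_cochain b ?e \<otimes>\<^bsub>C ?e\<^esub> b {i} ?e = b {j} ?e"
    using m by (simp add: e.m_assoc)
  then have "\<alpha> ?e \<tau> (edge_cochain b ?e) \<otimes>\<^bsub>C \<tau>\<^esub> \<alpha> ?e \<tau> (b {i} ?e) = \<alpha> ?e \<tau> (b {j} ?e)"
    using m a.hom_mult by metis
  then have "\<alpha> ?e \<tau> (edge_cochain b ?e) \<otimes>\<^bsub>C \<tau>\<^esub> (\<alpha> ?e \<tau> (b {i} ?e) \<otimes>\<^bsub>C \<tau>\<^esub> b ?e \<tau>)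
      = \<alpha> ?e \<tau> (b {j} ?e) \<otimes>\<^bsub>C \<tau>\<^esub> b ?e \<tau>"
    using m by (simp flip: t.m_assoc)
  then show ?thesis
    using poset_cocycle_comp[OF b f(1) et] poset_cocycle_comp[OF b f(2) et] by simp
qed

section \<open>Cocycles on edges and cocycles on the poset\<close>

lemma cocycles_iff:
  "a \<in> cocycles S G\<^sub>0 \<longleftrightarrow> a \<in> carrier (cochain_group S G\<^sub>0 1) \<and>
    (\<forall>i j k. i < j \<longrightarrow> j < k \<longrightarrow> {i, j, k} \<in> S \<longrightarrow>
      \<alpha> {i, k} {i, j, k} (a {i, k})
        = \<alpha> {j, k} {i, j, k} (a {j, k}) \<otimes>\<^bsub>C {i, j, k}\<^esub> \<alpha> {i, j} {i, j, k} (a {i, j}))"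
proof -
  have "\<alpha> {j, k} {i, j, k} (inv\<^bsub>C {j, k}\<^esub> a {j, k})
         \<otimes>\<^bsub>C {i, j, k}\<^esub> \<alpha> {i, k} {i, j, k} (a {i, k})
         \<otimes>\<^bsub>C {i, j, k}\<^esub> \<alpha> {i, j} {i, j, k} (inv\<^bsub>C {i, j}\<^esub> a {i, j}) = \<one>\<^bsub>C {i, j, k}\<^esub> \<longleftrightarrow>
      \<alpha> {i, k} {i, j, k} (a {i, k})
        = \<alpha> {j, k} {i, j, k} (a {j, k}) \<otimes>\<^bsub>C {i, j, k}\<^esub> \<alpha> {i, j} {i, j, k} (a {i, j})"
    if a: "a \<in> carrier (cochain_group S G\<^sub>0 1)" and ijk: "i < j" "j < k" "{i, j, k} \<in> S" for i j k
  proof -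
    let ?t = "{i, j, k}"
    have s: "{i, j} \<in> S" "{j, k} \<in> S" "{i, k} \<in> S" using simplex_subset[OF ijk(3)] by auto
    have f: "face {i, j} ?t" "face {j, k} ?t" "face {i, k} ?t" using s ijk by auto
    interpret t: group "C ?t" using coeff_group_group ijk by blast
    interpret ij: group_hom "C {i, j}" "C ?t" "\<alpha> {i, j} ?t"
      by (rule coeff_map_group_hom[OF f(1)])
    interpret jk: group_hom "C {j, k}" "C ?t" "\<alpha> {j, k} ?t"
      by (rule coeff_map_group_hom[OF f(2)])
    interpret ik: group_hom "C {i, k}" "C ?t" "\<alpha> {i, k} ?t"
      by (rule coeff_map_group_hom[OF f(3)])
    have "a {i, j} \<in> carrier (C {i, j})" "a {j, k} \<in> carrier (C {j, k})"
      "a {i, k} \<in> carrier (C {i, k})"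
      using cochain_closed[OF a] s ijk by (simp_all add: edge_iff del: One_nat_def)
    then show ?thesis by (simp add: t.inv_mult_inv_eq_one_iff)
  qed
  then show ?thesis
    unfolding cocycles_def using triangle_iff by auto
qed

text \<open>Over a triangle, both sides multiplied by \<open>b {i} {i, j, k}\<close> give
  \<open>b {k} {i, j, k}\<close>, one directly and one by way of the vertex \<open>j\<close>; cancel
  that factor.\<close>

lemma edge_cochain_cocycle:
  assumes b: "poset_cocycle b"
  shows "edge_cochain b \<in> cocycles S G\<^sub>0"
  unfolding cocycles_iff
proof (intro conjI allI impI edge_cochain_closed[OF b])
  fix i j k :: nat assume ijk: "i < j" "j < k" "{i, j, k} \<in> S"
  let ?t = "{i, j, k}"
  have s: "{i, j} \<in> S" "{j, k} \<in> S" "{i, k} \<in> S" "{i} \<in> S" "{j} \<in> S"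
    using simplex_subset[OF ijk(3)] by auto
  have f: "face {i, j} ?t" "face {j, k} ?t" "face {i, k} ?t" "face {i} ?t" "face {j} ?t"
    using s ijk by auto
  interpret t: group "C ?t" using coeff_group_group ijk by blast
  note ec = cochain_closed[OF edge_cochain_closed[OF b]]
  have m: "\<alpha> {i, j} ?t (edge_cochain b {i, j}) \<in> carrier (C ?t)"
    "\<alpha> {j, k} ?t (edge_cochain b {j, k}) \<in> carrier (C ?t)"
    "\<alpha> {i, k} ?t (edge_cochain b {i, k}) \<in> carrier (C ?t)"
    "b {i} ?t \<in> carrier (C ?t)"
    using f s ijk
    by (auto intro!: coeff_map_closed ec poset_cocycle_closed[OF b]
        simp: edge_iff simp del: One_nat_def)
  note e = edge_cochain_mult[OF b _ _ ijk(3)]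
  have "\<alpha> {i, k} ?t (edge_cochain b {i, k}) \<otimes>\<^bsub>C ?t\<^esub> b {i} ?t
      = \<alpha> {j, k} ?t (edge_cochain b {j, k}) \<otimes>\<^bsub>C ?t\<^esub>
          (\<alpha> {i, j} ?t (edge_cochain b {i, j}) \<otimes>\<^bsub>C ?t\<^esub> b {i} ?t)"
    using e[of i j] e[of j k] e[of i k] ijk by simp
  then show "\<alpha> {i, k} ?t (edge_cochain b {i, k})
      = \<alpha> {j, k} ?t (edge_cochain b {j, k}) \<otimes>\<^bsub>C ?t\<^esub> \<alpha> {i, j} ?t (edge_cochain b {i, j})"
    using m by (simp flip: t.m_assoc)
qed

text \<open>The poset cocycle is \<open>b \<sigma> \<tau> = a {Min \<tau>, Min \<sigma>}\<close>, mapped to \<open>C \<tau>\<close>: every class contains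
  the representative normalised by \<open>b {Min \<tau>} \<tau> = \<one>\<close>.\<close>

lemma ex_poset_cocycle_of_cocycle:
  assumes a: "a \<in> cocycles S G\<^sub>0"
  shows "\<exists>b. poset_cocycle b \<and> edge_cochain b = a"
proof -
  have a1: "a \<in> carrier (cochain_group S G\<^sub>0 1)" using a by (simp add: cocycles_iff)
  \<comment> \<open>Transitions inside \<tau> from \<open>i\<close> to \<open>j\<close>, extended by
    the identity to \<open>i = j\<close>, where \<open>a\<close> gives no edge value. Only pairs
    with \<open>i \<le> j\<close> are used below.\<close>
  define t where "t \<tau> i j = (if i = j then \<one>\<^bsub>C \<tau>\<^esub> else \<alpha> {i, j} \<tau> (a {i, j}))"
    for \<tau> and i j :: nat
  define b where "b \<sigma> \<tau> = t \<tau> (Min \<tau>) (Min \<sigma>)" for \<sigma> \<tau>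
  have ae: "a {i, j} \<in> carrier (C {i, j})" if "i < j" "{i, j} \<in> S" for i j
    using cochain_closed[OF a1] that edge_iff by blast
  have tc: "t \<tau> i j \<in> carrier (C \<tau>)" if "\<tau> \<in> S" "i \<in> \<tau>" "j \<in> \<tau>" "i \<le> j" for \<tau> i j
  proof (cases "i = j")
    case True
    then show ?thesis using group.is_monoid[OF coeff_group_group[OF that(1)]]
      by (simp add: t_def monoid.one_closed)
  next
    case False
    moreover have "{i, j} \<in> S" using simplex_subset[OF that(1)] that by auto
    ultimately show ?thesis using that ae by (auto simp: t_def intro: coeff_map_closed)
  qed
  have tt: "\<alpha> \<rho> \<tau> (t \<rho> i j) = t \<tau> i j"
    if f: "face \<rho> \<tau>" and ij: "i \<in> \<rho>" "j \<in> \<rho>" "i \<le> j" for \<rho> \<tau> i j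
  proof (cases "i = j")
    case True
    interpret group_hom "C \<rho>" "C \<tau>" "\<alpha> \<rho> \<tau>" by (rule coeff_map_group_hom[OF f])
    show ?thesis using True by (simp add: t_def)
  next
    case False
    have "{i, j} \<in> S" using simplex_subset[of \<rho>] f ij by auto
    then show ?thesis using False f ij ae by (simp add: t_def coeff_map_comp)
  qed
  \<comment> \<open>For three distinct vertices this is the cocycle condition of the triangle they
    span, pushed into \<tau>; if two neighbours coincide, one factor is the identity.\<close>
  have tm: "t \<tau> j k \<otimes>\<^bsub>C \<tau>\<^esub> t \<tau> i j = t \<tau> i k"
    if T: "\<tau> \<in> S" and m: "i \<in> \<tau>" "j \<in> \<tau>" "k \<in> \<tau>" and le: "i \<le> j" "j \<le> k" for \<tau> i j k
  proof -
    interpret t: group "C \<tau>" by (rule coeff_group_group[OF T])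
    consider "i = j" | "j = k" | "i < j" "j < k" using le by linarith
    then show ?thesis
    proof cases
      case 1 then show ?thesis using tc[OF T m(1,3)] le by (simp add: t_def[of \<tau> j j])
    next
      case 2 then show ?thesis using tc[OF T m(1,3)] le by (simp add: t_def[of \<tau> k k])
    next
      case 3
      let ?r = "{i, j, k}"
      have r: "?r \<in> S" using simplex_subset[OF T] m by auto
      then have f: "face ?r \<tau>" using T m by auto
      interpret rt: group_hom "C ?r" "C \<tau>" "\<alpha> ?r \<tau>" by (rule coeff_map_group_hom[OF f])
      have "t ?r i k = t ?r j k \<otimes>\<^bsub>C ?r\<^esub> t ?r i j"
        using a 3 r by (simp add: t_def cocycles_iff)
      then have "\<alpha> ?r \<tau> (t ?r i k) = \<alpha> ?r \<tau> (t ?r j k) \<otimes>\<^bsub>C \<tau>\<^esub> \<alpha> ?r \<tau> (t ?r i j)"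
        using tc[OF r] le by simp
      then show ?thesis using tt[OF f] le by simp
    qed
  qed
  \<comment> \<open>A face has the larger minimum. Along \<sigma> \<subseteq> \<rho> \<subseteq>
    \<tau> the minima therefore increase from \<tau> to \<sigma>, which is the order required by
    \<open>tm\<close>.\<close>
  have mins: "Min \<sigma> \<in> \<tau>" "Min \<tau> \<le> Min \<sigma>" if "face \<sigma> \<tau>" for \<sigma> \<tau>
    using that Min_simplex[of \<sigma>] simplex_finite[of \<tau>] by (auto intro: Min_le)
  have b: "poset_cocycle b"
    unfolding poset_cocycle_def
  proof (intro conjI allI impI)
    fix \<sigma> \<tau> assume f: "face \<sigma> \<tau>"
    then show "b \<sigma> \<tau> \<in> carrier (C \<tau>)"
      using mins[OF f] Min_simplex[of \<tau>] by (simp add: b_def tc)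
  next
    fix \<sigma> \<rho> \<tau> assume "face \<sigma> \<rho> \<and> face \<rho> \<tau>"
    then have f: "face \<sigma> \<rho>" "face \<rho> \<tau>" "face \<sigma> \<tau>" by auto
    show "\<alpha> \<rho> \<tau> (b \<sigma> \<rho>) \<otimes>\<^bsub>C \<tau>\<^esub> b \<rho> \<tau> = b \<sigma> \<tau>"
      using mins[OF f(1)] mins[OF f(2)] mins[OF f(3)] Min_simplex[of \<tau>] Min_simplex[of \<rho>] f
      by (simp add: b_def tt tm)
  qed
  moreover have "edge_cochain b = a"
  proof (rule cochain_eqI[OF edge_cochain_closed[OF b] a1])
    fix e assume e: "e \<in> simplices S 1"
    then obtain i j where ij: "i < j" "e = {i, j}" "{i, j} \<in> S" by (rule edgeE)
    note f = edge_faces[OF ij(1,3)]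
    interpret e: group "C {i, j}" using coeff_group_group ij by blast
    have "e \<in> S" using ij by simp
    \<comment> \<open>The edge has minimum \<open>i\<close>, so the value at \<open>i\<close> is the
      normalised one, and the value at \<open>j\<close> is \<open>a e\<close> up to
      \<open>\<alpha> e e\<close>, which acts trivially because \<open>\<psi> e e\<close> is the
      identity.\<close>
    have "b {i} e = \<one>\<^bsub>C e\<^esub>" "b {j} e = \<alpha> e e (a e)"
      using f ij by (simp_all add: b_def t_def)
    moreover have "\<alpha> e e (a e) = a e"
    proof (rule coeff_eq_psiI[of e e])
      have ce: "a e \<in> carrier (C e)" using cochain_closed[OF a1 e] .
      show "a e \<in> carrier (C e)" "\<alpha> e e (a e) \<in> carrier (C e)"
        using ce \<open>e \<in> S\<close> by (auto intro: coeff_map_closed)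
      show "\<psi> e e (\<alpha> e e (a e) x) = \<psi> e e (a e x)" if "x \<in> Gr e" for x
        using psi_coeff_map(2)[of e e "a e" x] ce \<open>e \<in> S\<close> that by (simp add: psi_self coeff_closed)
    qed (use \<open>e \<in> S\<close> in simp)
    ultimately show "edge_cochain b e = a e"
      using f cochain_closed[OF a1 e] unfolding ij(2) by (simp add: edge_cochain_def)
  qed
  ultimately show ?thesis by blast
qed

text \<open>Left to right, the restriction of \<phi> to the vertices is the acting 0-cochain. Right
  to left, the vertex values \<open>a\<close> determine each \<open>\<phi> \<sigma>\<close> through
  one vertex of \<sigma>; the action equations on edges make every other vertex give the same value,
  and this consistency implies the equation for all nested pairs.\<close>

lemma poset_cohomologous_iff:
  assumes b: "poset_cocycle b" and b': "poset_cocycle b'"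
  shows "(\<exists>\<phi>. (\<forall>\<sigma>\<in>S. \<phi> \<sigma> \<in> carrier (C \<sigma>)) \<and>
      (\<forall>\<sigma> \<tau>. face \<sigma> \<tau> \<longrightarrow> \<alpha> \<sigma> \<tau> (\<phi> \<sigma>) \<otimes>\<^bsub>C \<tau>\<^esub> b \<sigma> \<tau> = b' \<sigma> \<tau> \<otimes>\<^bsub>C \<tau>\<^esub> \<phi> \<tau>)) \<longleftrightarrow>
    edge_cochain b \<in> orbit (edge_cochain b')"
    (is "(\<exists>\<phi>. ?P \<phi>) \<longleftrightarrow> ?R")
proof
  note ec = edge_cochain_closed[OF b] and ec' = edge_cochain_closed[OF b']
  {
    assume "\<exists>\<phi>. ?P \<phi>"
    then obtain \<phi> where \<phi>: "\<And>\<sigma>. \<sigma> \<in> S \<Longrightarrow> \<phi> \<sigma> \<in> carrier (C \<sigma>)"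
      and eq: "\<And>\<sigma> \<tau>. face \<sigma> \<tau> \<Longrightarrow> \<alpha> \<sigma> \<tau> (\<phi> \<sigma>) \<otimes>\<^bsub>C \<tau>\<^esub> b \<sigma> \<tau> = b' \<sigma> \<tau> \<otimes>\<^bsub>C \<tau>\<^esub> \<phi> \<tau>"
      by blast
    define a where "a = restrict \<phi> (simplices S 0)"
    have a: "a \<in> carrier (cochain_group S G\<^sub>0 0)"
      using \<phi> by (auto simp: a_def cochain_carrier simplices_def)
    have "edge_cochain b = cochain_action S G\<^sub>0 (edge_cochain b') a"
      unfolding cochain_action_eq_iff[OF ec' a ec]
    proof (intro allI impI)
      fix i j :: nat assume ij: "i < j" "{i, j} \<in> S"
      let ?e = "{i, j}"
      note f = edge_faces[OF ij]
      interpret e: group "C ?e" using coeff_group_group f by blast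
      have ai: "a {i} = \<phi> {i}" "a {j} = \<phi> {j}" using f by (simp_all add: a_def)
      have m: "b {i} ?e \<in> carrier (C ?e)" "b {j} ?e \<in> carrier (C ?e)"
        "b' {i} ?e \<in> carrier (C ?e)" "b' {j} ?e \<in> carrier (C ?e)" "\<phi> ?e \<in> carrier (C ?e)"
        "\<alpha> {i} ?e (\<phi> {i}) \<in> carrier (C ?e)" "\<alpha> {j} ?e (\<phi> {j}) \<in> carrier (C ?e)"
        using f \<phi> poset_cocycle_closed[OF b] poset_cocycle_closed[OF b']
        by (auto intro!: coeff_map_closed)
      \<comment> \<open>Solved for \<open>b'\<close>, the equations at both endpoints end in the
        same factor, the inverse of \<open>\<phi> {i, j}\<close>, which cancels in the edge value of
        \<open>b'\<close>.\<close>
      have i: "b' {i} ?e = \<alpha> {i} ?e (\<phi> {i}) \<otimes>\<^bsub>C ?e\<^esub> b {i} ?e \<otimes>\<^bsub>C ?e\<^esub> inv\<^bsub>C ?e\<^esub> \<phi> ?e"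
        using eq[OF f(1)] m by (simp add: e.m_assoc)
      have j: "b' {j} ?e = \<alpha> {j} ?e (\<phi> {j}) \<otimes>\<^bsub>C ?e\<^esub> b {j} ?e \<otimes>\<^bsub>C ?e\<^esub> inv\<^bsub>C ?e\<^esub> \<phi> ?e"
        using eq[OF f(2)] m by (simp add: e.m_assoc)
      have "edge_cochain b' ?e \<otimes>\<^bsub>C ?e\<^esub> \<alpha> {i} ?e (\<phi> {i})
          = b' {j} ?e \<otimes>\<^bsub>C ?e\<^esub> inv\<^bsub>C ?e\<^esub> b' {i} ?e \<otimes>\<^bsub>C ?e\<^esub> \<alpha> {i} ?e (\<phi> {i})"
        using f by (simp add: edge_cochain_def)
      also have "\<dots> = \<alpha> {j} ?e (\<phi> {j}) \<otimes>\<^bsub>C ?e\<^esub> (b {j} ?e \<otimes>\<^bsub>C ?e\<^esub> inv\<^bsub>C ?e\<^esub> b {i} ?e)"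
        unfolding i j using m by (simp add: e.m_assoc e.inv_mult_group e.inv_solve_left')
      also have "\<dots> = \<alpha> {j} ?e (\<phi> {j}) \<otimes>\<^bsub>C ?e\<^esub> edge_cochain b ?e"
        using f by (simp add: edge_cochain_def)
      finally show "\<alpha> {j} ?e (a {j}) \<otimes>\<^bsub>C ?e\<^esub> edge_cochain b ?e
          = edge_cochain b' ?e \<otimes>\<^bsub>C ?e\<^esub> \<alpha> {i} ?e (a {i})"
        using ai by simp
    qed
    then show ?R using a by blast
  }
  assume ?R
  then obtain a where a: "a \<in> carrier (cochain_group S G\<^sub>0 0)"
    and act: "edge_cochain b = cochain_action S G\<^sub>0 (edge_cochain b') a" by blast
  have av: "a {v} \<in> carrier (C {v})" if "{v} \<in> S" for v
    using cochain_closed[OF a] that by (auto simp: vertices_iff)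
  \<comment> \<open>The solution of the coboundary equation for the vertex
    \<open>Min \<sigma>\<close> in \<sigma>, with \<open>a\<close> in place of \<phi> at that
    vertex.\<close>
  define \<phi> where "\<phi> \<sigma> = inv\<^bsub>C \<sigma>\<^esub> b' {Min \<sigma>} \<sigma> \<otimes>\<^bsub>C \<sigma>\<^esub> (\<alpha> {Min \<sigma>} \<sigma> (a {Min \<sigma>}) \<otimes>\<^bsub>C \<sigma>\<^esub> b {Min \<sigma>} \<sigma>)" for \<sigma>
  have vf: "face {v} \<sigma>" if "\<sigma> \<in> S" "v \<in> \<sigma>" for v \<sigma>
    using that simplex_subset[of \<sigma> "{v}"] by auto
  have mem: "b {v} \<sigma> \<in> carrier (C \<sigma>)" "b' {v} \<sigma> \<in> carrier (C \<sigma>)" "\<alpha> {v} \<sigma> (a {v}) \<in> carrier (C \<sigma>)"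
    if "\<sigma> \<in> S" "v \<in> \<sigma>" for v \<sigma>
    using vf[OF that] poset_cocycle_closed[OF b] poset_cocycle_closed[OF b']
      coeff_map_closed[OF vf[OF that] av]
    by simp_all
  have \<phi>: "\<phi> \<sigma> \<in> carrier (C \<sigma>)" if s: "\<sigma> \<in> S" for \<sigma>
  proof -
    interpret s: group "C \<sigma>" by (rule coeff_group_group[OF s])
    show ?thesis using mem[OF s Min_simplex[OF s]] by (simp add: \<phi>_def)
  qed
  \<comment> \<open>The equation solved at \<open>Min \<sigma>\<close> holds at every vertex
    \<open>v\<close> of \<sigma>: the action equation on the edge from \<open>Min \<sigma>\<close>
    to \<open>v\<close>, pushed into \<sigma>, relates the two, since by
    \<open>edge_cochain_mult\<close> the edge values carry \<open>b\<close> and \<open>b'\<close>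
    from one vertex to the other.\<close>
  have vert: "b' {v} \<sigma> \<otimes>\<^bsub>C \<sigma>\<^esub> \<phi> \<sigma> = \<alpha> {v} \<sigma> (a {v}) \<otimes>\<^bsub>C \<sigma>\<^esub> b {v} \<sigma>"
    if s: "\<sigma> \<in> S" and v: "v \<in> \<sigma>" for \<sigma> v
  proof -
    interpret s: group "C \<sigma>" by (rule coeff_group_group[OF s])
    let ?m = "Min \<sigma>"
    have m: "?m \<in> \<sigma>" by (rule Min_simplex[OF s])
    have base: "b' {?m} \<sigma> \<otimes>\<^bsub>C \<sigma>\<^esub> \<phi> \<sigma> = \<alpha> {?m} \<sigma> (a {?m}) \<otimes>\<^bsub>C \<sigma>\<^esub> b {?m} \<sigma>"
      using mem[OF s m] by (simp add: \<phi>_def flip: s.m_assoc)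
    show ?thesis
    proof (cases "v = ?m")
      case True then show ?thesis using base by simp
    next
      case False
      then have lt: "?m < v" using v simplex_finite[OF s] by (simp add: order_less_le)
      let ?e = "{?m, v}"
      have e: "?e \<in> S" using simplex_subset[OF s] m v by auto
      then have es: "face ?e \<sigma>" using s m v by auto
      note f = edge_faces[OF lt e]
      interpret es: group_hom "C ?e" "C \<sigma>" "\<alpha> ?e \<sigma>" by (rule coeff_map_group_hom[OF es])
      note E = cochain_closed[OF ec f(5)] cochain_closed[OF ec' f(5)]
      have aE: "\<alpha> {?m} ?e (a {?m}) \<in> carrier (C ?e)" "\<alpha> {v} ?e (a {v}) \<in> carrier (C ?e)"
        using mem(3)[OF e] by auto
      have "\<alpha> {v} ?e (a {v}) \<otimes>\<^bsub>C ?e\<^esub> edge_cochain b ?e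
          = edge_cochain b' ?e \<otimes>\<^bsub>C ?e\<^esub> \<alpha> {?m} ?e (a {?m})"
        using cochain_action_eq_iff[OF ec' a ec] act lt e by blast
      then have "\<alpha> ?e \<sigma> (\<alpha> {v} ?e (a {v})) \<otimes>\<^bsub>C \<sigma>\<^esub> \<alpha> ?e \<sigma> (edge_cochain b ?e)
          = \<alpha> ?e \<sigma> (edge_cochain b' ?e) \<otimes>\<^bsub>C \<sigma>\<^esub> \<alpha> ?e \<sigma> (\<alpha> {?m} ?e (a {?m}))"
        using E aE es.hom_mult by metis
      then have sq: "\<alpha> {v} \<sigma> (a {v}) \<otimes>\<^bsub>C \<sigma>\<^esub> \<alpha> ?e \<sigma> (edge_cochain b ?e)
          = \<alpha> ?e \<sigma> (edge_cochain b' ?e) \<otimes>\<^bsub>C \<sigma>\<^esub> \<alpha> {?m} \<sigma> (a {?m})"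
        using coeff_map_comp[OF f(1) es] coeff_map_comp[OF f(2) es] av f(1,2) by simp
      note mm = mem[OF s m] mem[OF s v] es.hom_closed[OF E(1)] es.hom_closed[OF E(2)] \<phi>[OF s]
      have "\<alpha> {v} \<sigma> (a {v}) \<otimes>\<^bsub>C \<sigma>\<^esub> b {v} \<sigma>
          = \<alpha> {v} \<sigma> (a {v}) \<otimes>\<^bsub>C \<sigma>\<^esub> \<alpha> ?e \<sigma> (edge_cochain b ?e) \<otimes>\<^bsub>C \<sigma>\<^esub> b {?m} \<sigma>"
        using edge_cochain_mult[OF b lt _ s] m v mm by (simp add: s.m_assoc)
      also have "\<dots> = \<alpha> ?e \<sigma> (edge_cochain b' ?e) \<otimes>\<^bsub>C \<sigma>\<^esub> b' {?m} \<sigma> \<otimes>\<^bsub>C \<sigma>\<^esub> \<phi> \<sigma>"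
        unfolding sq using mm base by (simp add: s.m_assoc)
      also have "\<dots> = b' {v} \<sigma> \<otimes>\<^bsub>C \<sigma>\<^esub> \<phi> \<sigma>"
        using edge_cochain_mult[OF b' lt _ s] m v by simp
      finally show ?thesis by simp
    qed
  qed
  have "?P \<phi>"
  proof (intro conjI ballI allI impI \<phi>)
    fix \<sigma> \<tau> assume f: "face \<sigma> \<tau>"
    interpret t: group "C \<tau>" using coeff_group_group f by blast
    interpret st: group_hom "C \<sigma>" "C \<tau>" "\<alpha> \<sigma> \<tau>" by (rule coeff_map_group_hom[OF f])
    \<comment> \<open>A vertex of \<sigma> is also one of \<tau>, so \<open>vert\<close> applies
      over both. After left multiplication by
      \<open>\<alpha> \<sigma> \<tau> (b' {v} \<sigma>)\<close>, each side of the desired equation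
      equals the product of \<open>b' {v} \<tau>\<close> and \<open>\<phi> \<tau>\<close>; then
      cancel.\<close>
    define v where "v = Min \<sigma>"
    have v: "\<sigma> \<in> S" "v \<in> \<sigma>" "\<tau> \<in> S" "v \<in> \<tau>" using f Min_simplex[of \<sigma>] by (auto simp: v_def)
    note ms = mem[OF v(1,2)] and mt = mem[OF v(3,4)]
    have m: "\<phi> \<sigma> \<in> carrier (C \<sigma>)" "\<phi> \<tau> \<in> carrier (C \<tau>)" "b \<sigma> \<tau> \<in> carrier (C \<tau>)" "b' \<sigma> \<tau> \<in> carrier (C \<tau>)"
      using \<phi> f poset_cocycle_closed[OF b f] poset_cocycle_closed[OF b' f] by auto
    have "\<alpha> \<sigma> \<tau> (b' {v} \<sigma>) \<otimes>\<^bsub>C \<tau>\<^esub> (\<alpha> \<sigma> \<tau> (\<phi> \<sigma>) \<otimes>\<^bsub>C \<tau>\<^esub> b \<sigma> \<tau>)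
        = \<alpha> \<sigma> \<tau> (b' {v} \<sigma> \<otimes>\<^bsub>C \<sigma>\<^esub> \<phi> \<sigma>) \<otimes>\<^bsub>C \<tau>\<^esub> b \<sigma> \<tau>"
      using ms m by (simp add: t.m_assoc)
    also have "\<dots> = \<alpha> {v} \<tau> (a {v}) \<otimes>\<^bsub>C \<tau>\<^esub> (\<alpha> \<sigma> \<tau> (b {v} \<sigma>) \<otimes>\<^bsub>C \<tau>\<^esub> b \<sigma> \<tau>)"
      unfolding vert[OF v(1,2)]
      using ms m av coeff_map_comp[OF vf[OF v(1,2)] f] vf[OF v(1,2)] mt
      by (simp add: t.m_assoc)
    also have "\<dots> = b' {v} \<tau> \<otimes>\<^bsub>C \<tau>\<^esub> \<phi> \<tau>"
      using poset_cocycle_comp[OF b vf[OF v(1,2)] f] vert[OF v(3,4)] by simp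
    also have "\<dots> = \<alpha> \<sigma> \<tau> (b' {v} \<sigma>) \<otimes>\<^bsub>C \<tau>\<^esub> (b' \<sigma> \<tau> \<otimes>\<^bsub>C \<tau>\<^esub> \<phi> \<tau>)"
      using poset_cocycle_comp[OF b' vf[OF v(1,2)] f] ms m by (simp flip: t.m_assoc)
    finally show "\<alpha> \<sigma> \<tau> (\<phi> \<sigma>) \<otimes>\<^bsub>C \<tau>\<^esub> b \<sigma> \<tau> = b' \<sigma> \<tau> \<otimes>\<^bsub>C \<tau>\<^esub> \<phi> \<tau>"
      using ms m by simp
  qed
  then show "\<exists>\<phi>. ?P \<phi>" by blast
qed

section \<open>The bijection\<close>

text \<open>Bridges a gap left by \<open>ex_amalgam_of_poset_cocycle\<close>, which matches the
  twist of an amalgam with a given poset cocycle on nested pairs only.\<close>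

lemma edge_cochain_cong:
  assumes "\<And>\<sigma> \<tau>. face \<sigma> \<tau> \<Longrightarrow> b \<sigma> \<tau> = b' \<sigma> \<tau>"
  shows "edge_cochain b = edge_cochain b'"
  unfolding edge_cochain_def
proof (rule restrict_ext)
  fix e assume "e \<in> simplices S 1"
  then obtain i j where ij: "i < j" "e = {i, j}" "{i, j} \<in> S" by (rule edgeE)
  note f = edge_faces[OF ij(1,3)]
  show "b {Max e} e \<otimes>\<^bsub>C e\<^esub> inv\<^bsub>C e\<^esub> b {Min e} e = b' {Max e} e \<otimes>\<^bsub>C e\<^esub> inv\<^bsub>C e\<^esub> b' {Min e} e"
    using f ij(2) assms[OF f(1)] assms[OF f(2)] by simp
qed

lemma ex_bij_betw_isomorphism_classes:
  "\<exists>f. bij_betw f (isomorphism_classes_of_type S G\<^sub>0) (cohomology_set S G\<^sub>0)"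
  unfolding isomorphism_classes_of_type_def
proof (rule bij_betw_quotient_of_kernel[where F = "\<lambda>A. orbit (edge_cochain (twist A))"])
  \<comment> \<open>Surjectivity: a cocycle on edges lifts to a poset cocycle, and that lifts to an
    amalgam.\<close>
  have "(\<lambda>A. edge_cochain (twist A)) ` amalgams_of_type S G\<^sub>0 = cocycles S G\<^sub>0"
  proof
    show "(\<lambda>A. edge_cochain (twist A)) ` amalgams_of_type S G\<^sub>0 \<subseteq> cocycles S G\<^sub>0"
      using edge_cochain_cocycle poset_cocycle_twist by blast
    show "cocycles S G\<^sub>0 \<subseteq> (\<lambda>A. edge_cochain (twist A)) ` amalgams_of_type S G\<^sub>0"
    proof
      fix a assume "a \<in> cocycles S G\<^sub>0"
      then obtain b where b: "poset_cocycle b" "edge_cochain b = a"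
        using ex_poset_cocycle_of_cocycle by blast
      then obtain A where A: "A \<in> amalgams_of_type S G\<^sub>0" "\<And>\<sigma> \<tau>. face \<sigma> \<tau> \<Longrightarrow> twist A \<sigma> \<tau> = b \<sigma> \<tau>"
        using ex_amalgam_of_poset_cocycle by blast
      have "edge_cochain (twist A) = a" using edge_cochain_cong[OF A(2)] b(2) by simp
      then show "a \<in> (\<lambda>A. edge_cochain (twist A)) ` amalgams_of_type S G\<^sub>0" using A(1) by blast
    qed
  qed
  then show "(\<lambda>A. orbit (edge_cochain (twist A))) ` amalgams_of_type S G\<^sub>0 = cohomology_set S G\<^sub>0"
    unfolding cohomology_set_def by (metis (no_types, lifting) image_cong image_image)
next
  fix A B
  \<comment> \<open>The fibres are the isomorphism classes: an isomorphism is a coboundary between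
    the twists, which means that the edge cochain of \<open>A\<close> lies in the orbit of that of
    \<open>B\<close>.\<close>
  have "amalgam_isomorphic S A B \<longleftrightarrow> orbit (edge_cochain (twist A)) = orbit (edge_cochain (twist B))"
    if "A \<in> amalgams_of_type S G\<^sub>0" "B \<in> amalgams_of_type S G\<^sub>0"
  proof -
    note b = poset_cocycle_twist[OF that(1)] poset_cocycle_twist[OF that(2)]
    show ?thesis
      unfolding amalgam_isomorphic_iff[OF that] poset_cohomologous_iff[OF b]
        orbit_eq_iff[OF edge_cochain_closed[OF b(2)] edge_cochain_closed[OF b(1)]] ..
  qed
  then show "(A, B) \<in> {(A, B). A \<in> amalgams_of_type S G\<^sub>0 \<and> B \<in> amalgams_of_type S G\<^sub>0 \<and>
        amalgam_isomorphic S A B} \<longleftrightarrow>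
      A \<in> amalgams_of_type S G\<^sub>0 \<and> B \<in> amalgams_of_type S G\<^sub>0 \<and>
      orbit (edge_cochain (twist A)) = orbit (edge_cochain (twist B))"
    by blast
qed

end

theorem theorem1:
  fixes n :: nat and S :: "nat set set" and G\<^sub>0 :: "'a amalgam"
  assumes "simplicial_complex n S"
    and "complex_connected n S"
    and "simplicial_amalgam S G\<^sub>0"
  shows "\<exists>f. bij_betw f (isomorphism_classes_of_type S G\<^sub>0) (cohomology_set S G\<^sub>0)"
proof -
  interpret amalgam_over_complex n S G\<^sub>0
    using assms by unfold_locales
  show ?thesis by (rule ex_bij_betw_isomorphism_classes)
qed

end
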